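(* Let $\alpha$ be a real number with $0<\alpha<1$. There is a positive constant $C_\alpha$, depending only on $\alpha$, such that for every non-zero complex number $\eta$, every meromorphic function $f\not\equiv 0$ on $\mathbb{C}$, and all real numbers $r>0$, $R$, $R'$ with $\max\{1,\,r+|\eta|\}<R<R'$, $$\begin{aligned} m\left(r,\frac{f(z+\eta)}{f(z)}\right)+m\left(r,\frac{f(z)}{f(z+\eta)}\right)\le{}&\frac{2|\eta|R}{(R-r-|\eta|)^2}\left(m\big(R,f\big)+m\Big(R,\frac1f\Big)\right)\\ &+\left(\frac{2R'}{R'-R}\right)\left(\frac{|\eta|}{R-r-|\eta|}+\frac{C_\alpha|\eta|^\alpha}{(1-\alpha)r^\alpha}\right)\left(N\big(R',f\big)+N\Big(R',\frac1f\Big)\right).\end{aligned}$$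
   Context: Meromorphic means meromorphic in the whole complex plane. For meromorphic $g$: $m(r,g)=\frac1{2\pi}\int_0^{2\pi}\log^+|g(re^{i\theta})|\,d\theta$; $n(t,g)$ is the number of poles of $g$ in $|z|\le t$, with multiplicity; $N(r,g)=\int_0^r\frac{n(t,g)-n(0,g)}{t}\,dt+n(0,g)\log r$. *)

theory Defs
  imports "HOL-Complex_Analysis.Complex_Analysis"
begin

definition log_plus :: "real \<Rightarrow> real" where
  "log_plus x = (if x \<le> 1 then 0 else ln x)"

text \<open>
  All notions below are insensitive to the values of a meromorphic function at the points of a
  sparse set. In particular the value that it is given at its poles is irrelevant.
\<close>

definition proximity_fun :: "real \<Rightarrow> (complex \<Rightarrow> complex) \<Rightarrow> real" where
  "proximity_fun r g =
     1 / (2 * pi) * integral {0..2 * pi} (\<lambda>\<theta>. log_plus (cmod (g (of_real r * cis \<theta>))))"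

text \<open>The multiplicity of a pole \<open>z\<close> of \<open>g\<close> is \<open>- zorder g z\<close>.\<close>

definition pole_count :: "real \<Rightarrow> (complex \<Rightarrow> complex) \<Rightarrow> nat" where
  "pole_count t g = (\<Sum>z | cmod z \<le> t \<and> is_pole g z. nat (- zorder g z))"

definition integrated_count :: "real \<Rightarrow> (complex \<Rightarrow> complex) \<Rightarrow> real" where
  "integrated_count r g =
     integral {0..r} (\<lambda>t. (real (pole_count t g) - real (pole_count 0 g)) / t)
     + real (pole_count 0 g) * ln r"

end

theory Submission
  imports Defs "HOL-Real_Asymp.Real_Asymp"
begin

text \<open>
  On the closed disc of radius \<open>R\<close> write \<open>f\<close> as \<open>exp L\<close> times the product of the
  \<open>(z - c) powi \<mu> c\<close> over its zeros and poles \<open>c\<close>, where \<open>\<mu> c\<close> is the order of \<open>f\<close> at \<open>c\<close>.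
  The Poisson formula for \<open>Re L\<close> and for each \<open>ln \<bar>z - c\<bar>\<close> gives the Poisson-Jensen formula, also
  when some \<open>c\<close> has modulus \<open>R\<close>. Hence \<open>ln \<bar>f (z + \<eta>) / f z\<bar>\<close> is the sum of three differences
  between \<open>z + \<eta>\<close> and \<open>z\<close>: of the Poisson kernels integrated against \<open>ln \<bar>f\<bar>\<close>, of the terms
  \<open>\<mu> c * ln \<bar>R\<^sup>2 - cnj c * z\<bar>\<close>, and of the terms \<open>\<mu> c * ln \<bar>z - c\<bar>\<close>. The first two are small pointwise;
  the last is at most a constant times \<open>\<bar>\<mu> c\<bar> * \<bar>\<eta>\<bar> powr \<alpha>\<close> times the sum of \<open>\<bar>z - c\<bar> powr (-\<alpha>)\<close> and
  \<open>\<bar>z + \<eta> - c\<bar> powr (-\<alpha>)\<close>, whose means over the circle of radius \<open>r\<close> are \<open>O(r powr (-\<alpha>))\<close>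
  uniformly in \<open>c\<close>. Finally the number of zeros and poles in the disc of radius \<open>R\<close> is controlled by
  the integrated counting functions at \<open>R'\<close>.
\<close>

subsection \<open>The Poisson formula\<close>

text \<open>Given as the real part of the Schwarz kernel instead of (R^2 - |z|^2) / |R e^(i theta) -
  z|^2, so that its variation in \<open>z\<close> is that of a rational function.\<close>

definition poisson_kernel :: "real \<Rightarrow> complex \<Rightarrow> real \<Rightarrow> real" where
  "poisson_kernel R z \<theta> = Re ((of_real R * cis \<theta> + z) / (of_real R * cis \<theta> - z))"

lemma poisson_kernel_diff_le:
  assumes "cmod z < R" "cmod w < R"
  shows "\<bar>poisson_kernel R w \<theta> - poisson_kernel R z \<theta>\<bar> \<le> 2 * R * cmod (w - z) / ((R - cmod w) * (R - cmod z))"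
proof -
  define u where "u = of_real R * cis \<theta>"
  have R: "R > 0" and u: "cmod u = R"
    using assms(1) norm_ge_zero[of z] by (auto simp: u_def norm_mult simp del: norm_ge_zero)
  have nz: "u - w \<noteq> 0" "u - z \<noteq> 0"
    using assms u by auto
  have "\<bar>poisson_kernel R w \<theta> - poisson_kernel R z \<theta>\<bar> = \<bar>Re ((u + w) / (u - w) - (u + z) / (u - z))\<bar>"
    by (simp add: poisson_kernel_def u_def)
  also have "(u + w) / (u - w) - (u + z) / (u - z) = 2 * u * (w - z) / ((u - w) * (u - z))"
    using nz by (simp add: divide_simps) (simp add: algebra_simps)
  also have "\<bar>Re \<dots>\<bar> \<le> cmod \<dots>"
    by (rule abs_Re_le_cmod)
  also have "\<dots> = 2 * R * cmod (w - z) / (cmod (u - w) * cmod (u - z))"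
    by (simp add: norm_mult norm_divide u)
  also have "\<dots> \<le> 2 * R * cmod (w - z) / ((R - cmod w) * (R - cmod z))"
    using norm_triangle_ineq2[of u w] norm_triangle_ineq2[of u z] assms R u
    by (intro divide_left_mono mult_mono mult_pos_pos) auto
  finally show ?thesis .
qed

text \<open>Cauchy's formula is applied to \<open>L w\<close> times the factor (R^2 - |z|^2) / (R^2
  - cnj z * w), which is 1 at w = z. On the circle R^2 = w * cnj w, and there this factor turns the
  Cauchy kernel into the Poisson kernel.\<close>

lemma poisson_integral_formula:
  assumes hol: "L holomorphic_on ball 0 R" and cont: "continuous_on (cball 0 R) L" and z: "cmod z < R"
  shows "((\<lambda>\<theta>. poisson_kernel R z \<theta> * Re (L (of_real R * cis \<theta>))) has_integral 2 * pi * Re (L z)) {0..2 * pi}"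
proof -
  have R: "R > 0"
    using z norm_ge_zero[of z] by linarith
  have nz: "of_real (R\<^sup>2) - cnj z * w \<noteq> 0" if "cmod w \<le> R" for w
  proof
    assume "of_real (R\<^sup>2) - cnj z * w = 0"
    hence "R\<^sup>2 = cmod (cnj z * w)"
      by (metis R eq_iff_diff_eq_0 norm_of_real abs_of_nonneg zero_le_power2)
    also have "\<dots> \<le> cmod z * R"
      using that by (auto simp: norm_mult intro: mult_left_mono)
    also have "\<dots> < R\<^sup>2"
      using z R by (simp add: power2_eq_square)
    finally show False by simp
  qed
  define h where "h = (\<lambda>w. L w * (of_real (R\<^sup>2 - (cmod z)\<^sup>2) / (of_real (R\<^sup>2) - cnj z * w)))"
  have "((\<lambda>u. h u / (u - z)) has_contour_integral (2 * of_real pi * \<i> * h z)) (circlepath 0 R)"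
  proof (rule Cauchy_integral_circlepath)
    show "continuous_on (cball 0 R) h"
      unfolding h_def using nz by (intro continuous_intros cont) auto
    show "h holomorphic_on ball 0 R"
      unfolding h_def using nz by (intro holomorphic_intros hol) auto
  qed (use z in auto)
  moreover have "h z = L z"
  proof -
    have "of_real (R\<^sup>2 - (cmod z)\<^sup>2) = of_real (R\<^sup>2) - cnj z * z"
      unfolding of_real_diff complex_norm_square by (simp add: mult.commute)
    thus ?thesis
      using nz[of z] z by (simp add: h_def)
  qed
  ultimately have "((\<lambda>t. h (of_real R * cis t) / (of_real R * cis t - z) * R * \<i> * cis t) has_integral
      2 * of_real pi * \<i> * L z) {0..2 * pi}"
    by (simp add: circlepath_def has_contour_integral_part_circlepath_iff)
  moreover have "h (of_real R * cis t) / (of_real R * cis t - z) * R * \<i> * cis t =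
      \<i> * (of_real (poisson_kernel R z t) * L (of_real R * cis t))" for t
  proof -
    define w where "w = of_real R * cis t"
    have w: "cmod w = R" "w * cnj w = of_real (R\<^sup>2)"
      using R by (auto simp: w_def norm_mult power2_eq_square cis_cnj cis_mult)
    have wz: "w - z \<noteq> 0" "w \<noteq> 0"
      using w z R by auto
    have wz': "cnj w - cnj z \<noteq> 0"
      using wz by (metis complex_cnj_cancel_iff eq_iff_diff_eq_0)
    have "complex_of_real (Re ((w + z) / (w - z))) = ((w + z) / (w - z) + cnj ((w + z) / (w - z))) / 2"
      by (subst complex_add_cnj) simp
    also have "\<dots> = (w * cnj w - z * cnj z) / ((w - z) * (cnj w - cnj z))"
      using wz wz' by (simp add: divide_simps) (simp add: algebra_simps)
    finally have P: "complex_of_real (poisson_kernel R z t) = (w * cnj w - z * cnj z) / ((w - z) * (cnj w - cnj z))"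
      by (simp add: poisson_kernel_def w_def)
    have h: "h w = L w * ((w * cnj w - z * cnj z) / (w * (cnj w - cnj z)))"
    proof -
      have "of_real (R\<^sup>2 - (cmod z)\<^sup>2) = w * cnj w - z * cnj z"
        unfolding of_real_diff complex_norm_square w(2) ..
      moreover have "of_real (R\<^sup>2) - cnj z * w = w * (cnj w - cnj z)"
        using w(2) by (simp add: algebra_simps)
      ultimately show ?thesis
        by (simp only: h_def)
    qed
    have "h w / (w - z) * \<i> * w = \<i> * (of_real (poisson_kernel R z t) * L w)"
      unfolding P h using wz wz' by (simp add: divide_simps)
    thus ?thesis
      by (simp add: w_def mult_ac)
  qed
  ultimately have "((\<lambda>t. \<i> * (of_real (poisson_kernel R z t) * L (of_real R * cis t))) has_integral
      2 * of_real pi * \<i> * L z) {0..2 * pi}"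
    by simp
  from has_integral_mult_right[OF this, of "-\<i>"] 
  have "((\<lambda>t. of_real (poisson_kernel R z t) * L (of_real R * cis t)) has_integral
      2 * of_real pi * L z) {0..2 * pi}"
    by (simp add: algebra_simps)
  from has_integral_linear[OF this bounded_linear_Re] show ?thesis
    by (simp add: o_def)
qed

subsection \<open>Singularities on and near a circle\<close>

text \<open>The Taylor remainder is at most |x|^3 / 6, and x^2 <= 1.6^2 < 3 makes this at most |x| /
  2.\<close>

lemma abs_sin_ge_half_abs:
  fixes x :: real
  assumes "\<bar>x\<bar> \<le> pi / 2"
  shows "\<bar>x\<bar> / 2 \<le> \<bar>sin x\<bar>"
proof -
  have "\<bar>sin x - (\<Sum>m<3. sin_coeff m * x ^ m)\<bar> \<le> inverse (fact 3) * \<bar>x\<bar> ^ 3"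
    by (rule Maclaurin_sin_bound)
  hence "\<bar>sin x - x\<bar> \<le> \<bar>x\<bar> ^ 3 / 6"
    by (simp add: eval_nat_numeral sin_coeff_def field_simps)
  moreover have "\<bar>x\<bar> \<le> 1.6"
    using assms pi_approx(2) by simp
  hence "\<bar>x\<bar>\<^sup>2 \<le> 1.6\<^sup>2"
    by (intro power_mono) auto
  hence "\<bar>x\<bar> * \<bar>x\<bar>\<^sup>2 \<le> \<bar>x\<bar> * 3"
    by (intro mult_left_mono) (auto simp: power2_eq_square)
  hence "\<bar>x\<bar> ^ 3 / 6 \<le> \<bar>x\<bar> / 2"
    by (simp add: eval_nat_numeral)
  ultimately show ?thesis
    by linarith
qed

lemma has_integral_abs_powr:
  assumes "a > (-1 :: real)" "b \<ge> 0"
  shows "((\<lambda>x. \<bar>x\<bar> powr a) has_integral 2 * (b powr (a + 1) / (a + 1))) {-b..b}"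
proof -
  have "((\<lambda>x. x powr a) has_integral b powr (a + 1) / (a + 1)) {0..b}"
    using assms by (rule has_integral_powr_from_0)
  hence pos: "((\<lambda>x. \<bar>x\<bar> powr a) has_integral b powr (a + 1) / (a + 1)) {0..b}"
    by (rule has_integral_eq[rotated]) auto
  have neg: "((\<lambda>x. \<bar>x\<bar> powr a) has_integral b powr (a + 1) / (a + 1)) {-b..0}"
    using has_integral_reflect_lemma_real[OF pos] by simp
  show ?thesis
    unfolding mult_2 by (rule has_integral_combine[OF _ _ neg pos]) (use assms in auto)
qed

text \<open>Enlarging \<open>{0..c}\<close> to the interval of radius \<open>b\<close> centred at
  the singularity \<open>s\<close> makes the bound independent of the position of
  \<open>s\<close>.\<close>

lemma integral_abs_shift_powr_le:
  fixes a s :: real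
  assumes "a > -1" "\<bar>s\<bar> \<le> b" "c + \<bar>s\<bar> \<le> b"
  shows "(\<lambda>x. \<bar>x - s\<bar> powr a) integrable_on {0..c}"
    and "integral {0..c} (\<lambda>x. \<bar>x - s\<bar> powr a) \<le> 2 * (b powr (a + 1) / (a + 1))"
proof -
  have "((\<lambda>x. \<bar>x\<bar> powr a) has_integral 2 * (b powr (a + 1) / (a + 1))) {-b..b}"
    using assms by (intro has_integral_abs_powr) auto
  hence *: "((\<lambda>x. \<bar>x - s\<bar> powr a) has_integral 2 * (b powr (a + 1) / (a + 1))) {-b + s..b + s}"
    by (subst has_integral_shift_Icc_real[symmetric]) (simp add: o_def)
  have sub: "{0..c} \<subseteq> {-b + s..b + s}"
    using assms by auto
  show **: "(\<lambda>x. \<bar>x - s\<bar> powr a) integrable_on {0..c}"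
    using * sub by (meson has_integral_integrable integrable_on_subinterval)
  show "integral {0..c} (\<lambda>x. \<bar>x - s\<bar> powr a) \<le> 2 * (b powr (a + 1) / (a + 1))"
    unfolding integral_unique[OF *, symmetric] using * ** sub
    by (intro integral_subset_le) auto
qed

text \<open>Rotating \<open>c\<close> onto the real axis and keeping only the imaginary part gives a
  lower bound free of the modulus of \<open>c\<close>; this is the source of the uniformity in
  \<open>c\<close> below.\<close>

lemma cmod_circle_minus_ge:
  assumes "r \<ge> 0" "c = of_real (cmod c) * cis \<psi>"
  shows "r * \<bar>sin (\<theta> - \<psi>)\<bar> \<le> cmod (of_real r * cis \<theta> - c)"
proof -
  have "of_real r * cis \<theta> - c = cis \<psi> * (of_real r * cis (\<theta> - \<psi>) - of_real (cmod c))"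
    by (subst assms(2)) (simp add: cis_divide[symmetric] algebra_simps)
  hence "cmod (of_real r * cis \<theta> - c) = cmod (of_real r * cis (\<theta> - \<psi>) - of_real (cmod c))"
    by (simp add: norm_mult)
  moreover have "\<bar>Im (of_real r * cis (\<theta> - \<psi>) - of_real (cmod c))\<bar> \<le> \<dots>"
    by (rule abs_Im_le_cmod)
  ultimately show ?thesis
    using assms(1) by (simp add: abs_mult)
qed

text \<open>Identities between meromorphic functions hold in a disc up to finitely many points; the
  corresponding angles are countable, hence invisible to integrals.\<close>

lemma negligible_circle_vimage:
  assumes "r \<noteq> 0" "finite E"
  shows "negligible {\<theta>. of_real r * cis \<theta> \<in> E}"
proof -
  have "countable {\<theta>. of_real r * cis \<theta> = c}" for c
  proof (cases "\<exists>\<theta>\<^sub>0. of_real r * cis \<theta>\<^sub>0 = c")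
    case True
    then obtain \<theta>\<^sub>0 where t0: "of_real r * cis \<theta>\<^sub>0 = c"
      by blast
    have "{\<theta>. of_real r * cis \<theta> = c} \<subseteq> range (\<lambda>k::int. \<theta>\<^sub>0 + 2 * pi * k)"
    proof
      fix \<theta> assume "\<theta> \<in> {\<theta>. of_real r * cis \<theta> = c}"
      hence "cis \<theta> = cis \<theta>\<^sub>0"
        using t0 assms(1) by auto
      hence "sin \<theta> = sin \<theta>\<^sub>0 \<and> cos \<theta> = cos \<theta>\<^sub>0"
        by (simp add: complex_eq_iff)
      then obtain k :: int where "\<theta> = \<theta>\<^sub>0 + 2 * pi * k"
        unfolding sin_cos_eq_iff by (auto simp: mult_ac)
      thus "\<theta> \<in> range (\<lambda>k::int. \<theta>\<^sub>0 + 2 * pi * k)"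
        by blast
    qed
    thus ?thesis
      by (meson countable_image countable_subset uncountable_def countableI_type)
  qed auto
  hence "countable (\<Union>c\<in>E. {\<theta>. of_real r * cis \<theta> = c})"
    using assms(2) by (intro countable_UN) (auto intro: countable_finite)
  moreover have "(\<Union>c\<in>E. {\<theta>. of_real r * cis \<theta> = c}) = {\<theta>. of_real r * cis \<theta> \<in> E}"
    by auto
  ultimately have "negligible (\<Union> ((\<lambda>x. {x}) ` {\<theta>. of_real r * cis \<theta> \<in> E}))"
    by (intro negligible_countable_Union) auto
  thus ?thesis
    by simp
qed

text \<open>Each angle lies within pi / 2 of a zero \<open>s k\<close> of sin (theta - psi), and the
  distance to \<open>c\<close> is at least r / 2 times |theta - s k|. So the integrand is dominated
  by finitely many shifted powers, whose integrals are bounded independently of \<open>c\<close>,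
  and the power of \<open>r\<close> factors out.\<close>

lemma circle_powr_integral_bound:
  fixes \<alpha> :: real
  assumes "0 < \<alpha>" "\<alpha> < 1"
  obtains K where "K > 0"
    and "\<And>r c. r > 0 \<Longrightarrow> (\<lambda>\<theta>. cmod (of_real r * cis \<theta> - c) powr (-\<alpha>)) integrable_on {0..2 * pi}"
    and "\<And>r c. r > 0 \<Longrightarrow> integral {0..2 * pi} (\<lambda>\<theta>. cmod (of_real r * cis \<theta> - c) powr (-\<alpha>)) \<le> K * r powr (-\<alpha>)"
proof -
  \<comment> \<open>The shifts \<open>s k\<close> below satisfy |s k| <= 5 pi and the interval has
    length 2 pi, so radius 8 pi suffices in \<open>integral_abs_shift_powr_le\<close>. In
    \<open>K\<close>, 7 counts the indices from -3 to 3 and \<open>2 powr \<alpha>\<close> comes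
    from \<open>(r / 2) powr (-\<alpha>)\<close>.\<close>
  define B where "B = 2 * ((8 * pi) powr (-\<alpha> + 1) / (-\<alpha> + 1))"
  define K where "K = 2 powr \<alpha> * (7 * B)"
  have "B > 0"
    using assms pi_gt_zero by (auto simp: B_def intro!: divide_pos_pos)
  hence "K > 0"
    by (simp add: K_def)
  have main: "(\<lambda>\<theta>. cmod (of_real r * cis \<theta> - c) powr (-\<alpha>)) integrable_on {0..2 * pi} \<and>
      integral {0..2 * pi} (\<lambda>\<theta>. cmod (of_real r * cis \<theta> - c) powr (-\<alpha>)) \<le> K * r powr (-\<alpha>)"
    if r: "r > 0" for r :: real and c :: complex
  proof -
    define F where "F = (\<lambda>\<theta>. cmod (of_real r * cis \<theta> - c) powr (-\<alpha>))"
    define \<psi> where "\<psi> = Arg2pi c"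
    have psi: "0 \<le> \<psi>" "\<psi> < 2 * pi" "c = of_real (cmod c) * cis \<psi>"
      using Arg2pi[of c] by (auto simp: \<psi>_def cis_conv_exp is_Arg_def)
    define s where "s = (\<lambda>k::int. \<psi> + k * pi)"
    define g where "g = (\<lambda>\<theta>. \<Sum>k\<in>{-3..3}. (r / 2) powr (-\<alpha>) * \<bar>\<theta> - s k\<bar> powr (-\<alpha>))"
    have int: "(\<lambda>x. \<bar>x - s k\<bar> powr (-\<alpha>)) integrable_on {0..2 * pi}"
        "integral {0..2 * pi} (\<lambda>x. \<bar>x - s k\<bar> powr (-\<alpha>)) \<le> B" if k: "k \<in> {-3..3}" for k
    proof -
      have "\<bar>k\<bar> \<le> 3"
        using k by auto
      hence "\<bar>of_int k\<bar> \<le> (3::real)"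
        by linarith
      hence "\<bar>of_int k * pi\<bar> \<le> 3 * pi"
        unfolding abs_mult by (intro mult_mono) auto
      hence "\<bar>s k\<bar> \<le> 5 * pi"
        using psi by (simp add: s_def)
      thus "(\<lambda>x. \<bar>x - s k\<bar> powr (-\<alpha>)) integrable_on {0..2 * pi}"
        "integral {0..2 * pi} (\<lambda>x. \<bar>x - s k\<bar> powr (-\<alpha>)) \<le> B"
        unfolding B_def
        using integral_abs_shift_powr_le[of "-\<alpha>" "s k" "8 * pi" "2 * pi"] assms pi_gt_zero by auto
    qed
    have g_int: "g integrable_on {0..2 * pi}"
      unfolding g_def using int by (intro integrable_sum integrable_on_mult_right) auto
    have "integral {0..2 * pi} g = (\<Sum>k\<in>{-3..3}. (r / 2) powr (-\<alpha>) * integral {0..2 * pi} (\<lambda>x. \<bar>x - s k\<bar> powr (-\<alpha>)))"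
      unfolding g_def using int by (subst integral_sum) (auto intro!: integrable_on_mult_right)
    also have "\<dots> \<le> (\<Sum>k\<in>{-3..3::int}. (r / 2) powr (-\<alpha>) * B)"
      using int by (intro sum_mono mult_left_mono) auto
    also have "\<dots> = K * r powr (-\<alpha>)"
      using r by (simp add: K_def powr_divide powr_minus field_simps)
    finally have g_le: "integral {0..2 * pi} g \<le> K * r powr (-\<alpha>)" .
    have le: "F \<theta> \<le> g \<theta>" if th: "\<theta> \<in> {0..2 * pi} - s ` {-3..3}" for \<theta>
    proof -
      \<comment> \<open>\<open>s k\<close> is the zero nearest to theta. As theta and psi lie in
        [0, 2 pi], |k| pi is at most 2 pi + pi / 2, which confines \<open>k\<close> to the range
        from -3 to 3.\<close>
      define k where "k = round ((\<theta> - \<psi>) / pi)"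
      have "\<bar>of_int k - (\<theta> - \<psi>) / pi\<bar> \<le> 1 / 2"
        unfolding k_def by (rule of_int_round_abs_le)
      hence "\<bar>of_int k - (\<theta> - \<psi>) / pi\<bar> * pi \<le> 1 / 2 * pi"
        by (intro mult_right_mono) auto
      also have "\<bar>of_int k - (\<theta> - \<psi>) / pi\<bar> * pi = \<bar>(of_int k - (\<theta> - \<psi>) / pi) * pi\<bar>"
        by (simp add: abs_mult)
      also have "(of_int k - (\<theta> - \<psi>) / pi) * pi = s k - \<theta>"
        by (simp add: s_def field_simps)
      finally have near: "\<bar>\<theta> - s k\<bar> \<le> pi / 2"
        by (simp add: abs_minus_commute)
      have "\<bar>of_int k * pi\<bar> \<le> 3 * pi"
      proof -
        have "0 \<le> \<theta>" "\<theta> \<le> 2 * pi"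
          using th by auto
        thus ?thesis
          using near psi(1,2) unfolding s_def abs_le_iff by linarith
      qed
      hence "\<bar>real_of_int k\<bar> \<le> 3"
        by (simp add: abs_mult)
      hence k3: "k \<in> {-3..3}"
        by auto
      hence pos: "\<bar>\<theta> - s k\<bar> > 0"
        using th by auto
      have "\<bar>\<theta> - s k\<bar> / 2 \<le> \<bar>sin (\<theta> - s k)\<bar>"
        by (rule abs_sin_ge_half_abs[OF near])
      also have "sin (\<theta> - s k) = sin (\<theta> - \<psi>) * cos (of_int k * pi)"
        using sin_diff[of "\<theta> - \<psi>" "of_int k * pi"] by (simp add: s_def algebra_simps)
      also have "\<bar>\<dots>\<bar> = \<bar>sin (\<theta> - \<psi>)\<bar>"
        using cos_npi_int[of k] by (simp add: abs_mult mult.commute)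
      finally have "r * (\<bar>\<theta> - s k\<bar> / 2) \<le> r * \<bar>sin (\<theta> - \<psi>)\<bar>"
        using r by (intro mult_left_mono) auto
      also have "\<dots> \<le> cmod (of_real r * cis \<theta> - c)"
        using r psi by (intro cmod_circle_minus_ge) auto
      finally have "F \<theta> \<le> (r * (\<bar>\<theta> - s k\<bar> / 2)) powr (-\<alpha>)"
        unfolding F_def using assms r pos by (intro powr_mono2') auto
      also have "\<dots> = (r / 2) powr (-\<alpha>) * \<bar>\<theta> - s k\<bar> powr (-\<alpha>)"
        using r by (simp add: powr_mult[symmetric])
      also have "\<dots> \<le> g \<theta>"
        unfolding g_def using k3 by (intro member_le_sum) auto
      finally show ?thesis .
    qed
    \<comment> \<open>At the points \<open>s k\<close> the pointwise bound may fail, since there \<open>0 powr (-\<alpha>)\<close> is \<open>0\<close>.\<close>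
    define g' where "g' = (\<lambda>\<theta>. if \<theta> \<in> s ` {-3..3} then F \<theta> else g \<theta>)"
    have g': "(g' has_integral integral {0..2 * pi} g) {0..2 * pi}"
      by (rule has_integral_spike_finite[OF _ _ integrable_integral[OF g_int], of "s ` {-3..3}"])
         (auto simp: g'_def)
    have le': "F \<theta> \<le> g' \<theta>" if "\<theta> \<in> {0..2 * pi}" for \<theta>
      using le[of \<theta>] that by (auto simp: g'_def)
    have F_nonneg: "F \<theta> \<ge> 0" for \<theta>
      by (simp add: F_def)
    have F_int: "F integrable_on {0..2 * pi}"
    proof (rule measurable_bounded_by_integrable_imp_integrable_real)
      have "F \<in> borel_measurable borel"
        unfolding F_def cis_conv_exp by measurable
      thus "F \<in> borel_measurable (lebesgue_on {0..2 * pi})"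
        by (simp add: measurable_completion measurable_restrict_space1)
      show "g' integrable_on {0..2 * pi}"
        using g' by blast
    qed (use le' F_nonneg in auto)
    moreover have "integral {0..2 * pi} F \<le> integral {0..2 * pi} g'"
      using F_int g' le' by (intro integral_le) auto
    ultimately show ?thesis
      using g_le integral_unique[OF g'] by (simp add: F_def)
  qed
  show thesis
    using that[OF \<open>K > 0\<close>] main by blast
qed

section \<open>Logarithmic singularities on a circle\<close>

lemma abs_ln_le:
  fixes x :: real
  assumes "x \<ge> 0"
  shows "\<bar>ln x\<bar> \<le> x + 2 * x powr (-(1 / 2))"
\<comment> \<open>At 0 both sides are 0, since \<open>ln 0 = 0\<close> and
  \<open>0 powr a = 0\<close>.\<close>
proof (cases "x = 0 \<or> x \<ge> 1")
  case True
  thus ?thesis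
    using ln_le_minus_one[of x] by (auto simp: add_increasing2)
next
  case False
  hence x: "0 < x" "x < 1"
    using assms by auto
  \<comment> \<open>This trades the logarithm for a power with exponent above -1, which is
    integrable along the circle.\<close>
  have "- ln x = 2 * ln (x powr (-(1 / 2)))"
    using x by (simp add: ln_powr)
  also have "\<dots> \<le> 2 * x powr (-(1 / 2))"
    using x ln_le_minus_one[of "x powr (-(1 / 2))"] by simp
  finally show ?thesis
    using x by simp
qed

lemma ln_cmod_circle_absolutely_integrable:
  assumes "r > 0"
  shows "(\<lambda>\<theta>. ln (cmod (of_real r * cis \<theta> - c))) absolutely_integrable_on {0..2 * pi}"
proof -
  define F where "F = (\<lambda>\<theta>. ln (cmod (of_real r * cis \<theta> - c)))"
  define G where "G = (\<lambda>\<theta>. cmod (of_real r * cis \<theta> - c) + 2 * cmod (of_real r * cis \<theta> - c) powr (-(1 / 2)))"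
  obtain K where "\<And>r c. r > 0 \<Longrightarrow>
      (\<lambda>\<theta>. cmod (of_real r * cis \<theta> - c) powr (-(1 / 2))) integrable_on {0..2 * pi}"
    using circle_powr_integral_bound[of "1 / 2"] by auto
  hence "(\<lambda>\<theta>. 2 * cmod (of_real r * cis \<theta> - c) powr (-(1 / 2))) integrable_on {0..2 * pi}"
    using assms by (intro integrable_on_mult_right)
  moreover have "(\<lambda>\<theta>. cmod (of_real r * cis \<theta> - c)) integrable_on {0..2 * pi}"
    by (intro integrable_continuous_real continuous_intros)
  ultimately have G: "G integrable_on {0..2 * pi}"
    unfolding G_def by (rule integrable_add[rotated])
  have le: "\<bar>F \<theta>\<bar> \<le> G \<theta>" for \<theta>
    unfolding F_def G_def by (intro abs_ln_le) auto
  have "F integrable_on {0..2 * pi}"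
  proof (rule measurable_bounded_by_integrable_imp_integrable_real)
    have "F \<in> borel_measurable borel"
      unfolding F_def cis_conv_exp by measurable
    thus "F \<in> borel_measurable (lebesgue_on {0..2 * pi})"
      by (simp add: measurable_completion measurable_restrict_space1)
  qed (use le G in auto)
  thus ?thesis
    using le G unfolding F_def[symmetric]
    by (intro absolutely_integrable_integrable_bound[where g = G]) auto
qed

section \<open>The Poisson formula for the logarithm of the distance to a point\<close>

lemma abs_poisson_kernel_le:
  assumes "cmod z < R"
  shows "\<bar>poisson_kernel R z \<theta>\<bar> \<le> (R + cmod z) / (R - cmod z)"
proof -
  have R: "R > 0"
    using assms norm_ge_zero[of z] by linarith
  have u: "cmod (of_real R * cis \<theta>) = R"
    using R by (simp add: norm_mult)
  have "\<bar>poisson_kernel R z \<theta>\<bar> \<le> cmod ((of_real R * cis \<theta> + z) / (of_real R * cis \<theta> - z))"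
    unfolding poisson_kernel_def by (rule abs_Re_le_cmod)
  also have "\<dots> = cmod (of_real R * cis \<theta> + z) / cmod (of_real R * cis \<theta> - z)"
    by (rule norm_divide)
  also have "\<dots> \<le> (R + cmod z) / (R - cmod z)"
    using norm_triangle_ineq[of "of_real R * cis \<theta>" z] norm_triangle_ineq2[of "of_real R * cis \<theta>" z] assms R u
    by (intro frac_le) auto
  finally show ?thesis .
qed

text \<open>The factor can vanish only at the reflection of \<open>a\<close> in the circle of radius
  \<open>R\<close>, which lies outside the open disc.\<close>

lemma cmod_reflected_factor_pos:
  assumes "cmod a \<le> R" "cmod z < R"
  shows "cmod (of_real (R\<^sup>2) - cnj a * z) > 0"
proof -
  have R: "R > 0"
    using assms(2) norm_ge_zero[of z] by linarith
  have "cmod (cnj a * z) \<le> R * cmod z"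
    using assms by (simp add: norm_mult mult_right_mono)
  also have "\<dots> < R\<^sup>2"
    using assms R by (simp add: power2_eq_square)
  finally have "cmod (cnj a * z) < cmod (of_real (R\<^sup>2))"
    by (simp add: norm_power)
  thus ?thesis
    using norm_triangle_ineq2[of "of_real (R\<^sup>2)" "cnj a * z"] by linarith
qed

text \<open>On the circle |w - a| = |R - cnj a * w / R|, and the function inside the right-hand
  modulus has positive real part on the closed disc. The Poisson formula therefore applies to its
  principal logarithm.\<close>

lemma poisson_integral_ln_cmod_less:
  assumes a: "cmod a < R" and z: "cmod z < R"
  shows "((\<lambda>\<theta>. poisson_kernel R z \<theta> * ln (cmod (of_real R * cis \<theta> - a))) has_integral
           2 * pi * ln (cmod (of_real (R\<^sup>2) - cnj a * z) / R)) {0..2 * pi}"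
proof -
  have R: "R > 0"
    using z norm_ge_zero[of z] by linarith
  define h where "h = (\<lambda>w. of_real R - cnj a * w / of_real R)"
  have h: "h w \<notin> \<real>\<^sub>\<le>\<^sub>0" if "cmod w \<le> R" for w
  proof -
    have "cmod (cnj a * w / of_real R) = cmod a * cmod w / R"
      using R by (simp add: norm_mult norm_divide)
    also have "\<dots> \<le> cmod a * R / R"
      using that R by (intro divide_right_mono mult_left_mono) auto
    also have "\<dots> < R"
      using a R by simp
    finally have "Re (h w) > 0"
      unfolding h_def using complex_Re_le_cmod[of "cnj a * w / of_real R"] by simp
    thus ?thesis
      by (auto simp: complex_nonpos_Reals_iff)
  qed
  have hnz: "h w \<noteq> 0" if "cmod w \<le> R" for w
    using h[OF that] by auto
  have "((\<lambda>\<theta>. poisson_kernel R z \<theta> * Re (Ln (h (of_real R * cis \<theta>)))) has_integral 2 * pi * Re (Ln (h z))) {0..2 * pi}"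
  proof (rule poisson_integral_formula)
    show "(\<lambda>w. Ln (h w)) holomorphic_on ball 0 R"
      unfolding h_def by (intro holomorphic_intros) (use R h in \<open>auto simp: h_def\<close>)
    show "continuous_on (cball 0 R) (\<lambda>w. Ln (h w))"
      unfolding h_def by (intro continuous_intros) (use R h in \<open>auto simp: h_def\<close>)
  qed fact
  moreover have "Re (Ln (h (of_real R * cis \<theta>))) = ln (cmod (of_real R * cis \<theta> - a))" for \<theta>
  proof -
    define w where "w = of_real R * cis \<theta>"
    have w: "cmod w = R" "w * cnj w = of_real (R\<^sup>2)"
      using R by (auto simp: w_def norm_mult power2_eq_square cis_cnj cis_mult)
    have "h w = w * cnj (w - a) / of_real R"
      using R w(2) by (simp add: h_def field_simps power2_eq_square)
    hence "cmod (h w) = cmod (w - a)"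
      using R w(1) by (simp add: norm_mult norm_divide del: complex_cnj_diff)
    thus ?thesis
      using hnz[of w] w by (simp add: w_def)
  qed
  moreover have "Re (Ln (h z)) = ln (cmod (of_real (R\<^sup>2) - cnj a * z) / R)"
  proof -
    have "h z = (of_real (R\<^sup>2) - cnj a * z) / of_real R"
      using R by (simp add: h_def field_simps power2_eq_square)
    hence "cmod (h z) = cmod (of_real (R\<^sup>2) - cnj a * z) / R"
      using R by (simp only: norm_divide norm_of_real)
    thus ?thesis
      using hnz[of z] z by simp
  qed
  ultimately show ?thesis
    by simp
qed

text \<open>
  If \<open>a\<close> lies on the circle, the logarithmic singularity is on the path of integration; the formula
  is then the limit of the formula for the points \<open>t a\<close> with \<open>t < 1\<close>.
\<close>

lemma poisson_integral_ln_cmod: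
  assumes a: "cmod a \<le> R" and z: "cmod z < R"
  shows "((\<lambda>\<theta>. poisson_kernel R z \<theta> * ln (cmod (of_real R * cis \<theta> - a))) has_integral
           2 * pi * ln (cmod (of_real (R\<^sup>2) - cnj a * z) / R)) {0..2 * pi}"
proof (cases "cmod a = R")
  case False
  thus ?thesis
    using a z by (intro poisson_integral_ln_cmod_less) auto
next
  case aR: True
  have R: "R > 0"
    using z norm_ge_zero[of z] by linarith
  define N where "N = {\<theta>. of_real R * cis \<theta> \<in> {a}}"
  have N: "negligible N"
    unfolding N_def using R by (intro negligible_circle_vimage) auto
  define t where "t = (\<lambda>n. 1 - 1 / real (n + 2))"
  have t: "0 \<le> t n" "t n < 1" for n
    by (auto simp: t_def)
  have t_lim: "t \<longlonglongrightarrow> 1"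
    unfolding t_def by real_asymp
  define M where "M = (R + cmod z) / (R - cmod z)"
  \<comment> \<open>Dominating function for the limit. For w on the circle, |w - a| <= |w - t a| +
    (1 - t) R and (1 - t) R <= |w - t a|, so |w - t a| >= |w - a| / 2; also |w - t a| <= 2
    R.\<close>
  define H where "H = (\<lambda>\<theta>. M * (\<bar>ln (cmod (of_real R * cis \<theta> - a))\<bar> + (ln 2 + \<bar>ln (2 * R)\<bar>)))"
  have M: "\<bar>poisson_kernel R z \<theta>\<bar> \<le> M" for \<theta>
    unfolding M_def by (rule abs_poisson_kernel_le) fact
  have "M \<ge> 0"
    using M[of 0] by linarith
  \<comment> \<open>At an angle where the circle meets \<open>a\<close>, the logarithms for
    \<open>t n\<close> tend to minus infinity whereas \<open>ln 0 = 0\<close>; setting the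
    integrands to 0 on the null set \<open>N\<close> restores convergence.\<close>
  define F where "F = (\<lambda>n \<theta>. if \<theta> \<in> N then 0 else poisson_kernel R z \<theta> * ln (cmod (of_real R * cis \<theta> - of_real (t n) * a)))"
  define G where "G = (\<lambda>\<theta>. if \<theta> \<in> N then 0 else poisson_kernel R z \<theta> * ln (cmod (of_real R * cis \<theta> - a)))"
  have "(G has_integral 2 * pi * ln (cmod (of_real (R\<^sup>2) - cnj a * z) / R)) {0..2 * pi}"
  proof (rule has_integral_dominated_convergence)
    show "(F n has_integral 2 * pi * ln (cmod (of_real (R\<^sup>2) - cnj (of_real (t n) * a) * z) / R)) {0..2 * pi}" for n
    proof (rule has_integral_spike[OF N])
      have "cmod (of_real (t n) * a) < R"
        using t[of n] R by (simp add: norm_mult aR)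
      thus "((\<lambda>\<theta>. poisson_kernel R z \<theta> * ln (cmod (of_real R * cis \<theta> - of_real (t n) * a))) has_integral
          2 * pi * ln (cmod (of_real (R\<^sup>2) - cnj (of_real (t n) * a) * z) / R)) {0..2 * pi}"
        using z by (intro poisson_integral_ln_cmod_less)
    qed (auto simp: F_def)
    show "H integrable_on {0..2 * pi}"
    proof -
      have "(\<lambda>\<theta>. \<bar>ln (cmod (of_real R * cis \<theta> - a))\<bar>) integrable_on {0..2 * pi}"
        using ln_cmod_circle_absolutely_integrable[OF R, of a] by (simp add: absolutely_integrable_on_def)
      thus ?thesis
        unfolding H_def by (intro integrable_on_mult_right integrable_add) auto
    qed
    show "\<forall>\<theta>\<in>{0..2 * pi}. norm (F n \<theta>) \<le> H \<theta>" for n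
    proof
      fix \<theta>
      show "norm (F n \<theta>) \<le> H \<theta>"
      proof (cases "\<theta> \<in> N")
        case True
        thus ?thesis
          using \<open>M \<ge> 0\<close> by (auto simp: F_def H_def intro!: mult_nonneg_nonneg add_nonneg_nonneg)
      next
        case False
        define w where "w = of_real R * cis \<theta>"
        have w: "cmod w = R" "w \<noteq> a"
          using R False by (auto simp: w_def norm_mult N_def)
        have "w - a = (w - of_real (t n) * a) - of_real (1 - t n) * a"
          by (simp add: algebra_simps)
        hence 1: "cmod (w - a) \<le> cmod (w - of_real (t n) * a) + (1 - t n) * R"
          using norm_triangle_ineq4[of "w - of_real (t n) * a" "of_real (1 - t n) * a"] t[of n] aR
          by (simp only: norm_mult norm_of_real abs_of_pos less_iff_diff_less_0[of "t n"] diff_gt_0_iff_gt)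
        have ta: "cmod (of_real (t n) * a) = t n * R"
          using t[of n] aR by (simp add: norm_mult)
        have 2: "(1 - t n) * R \<le> cmod (w - of_real (t n) * a)"
          using norm_triangle_ineq2[of w "of_real (t n) * a"] w ta by (simp add: algebra_simps)
        have "t n * R \<le> R"
          using t[of n] R by simp
        hence 3: "cmod (w - of_real (t n) * a) \<le> 2 * R"
          using norm_triangle_ineq4[of w "of_real (t n) * a"] w ta by linarith
        have 4: "cmod (w - a) / 2 \<le> cmod (w - of_real (t n) * a)" "cmod (w - a) / 2 > 0"
          using 1 2 w by auto
        have "ln (cmod (w - of_real (t n) * a)) \<ge> ln (cmod (w - a) / 2)"
          using 4 by (subst ln_le_cancel_iff) auto
        moreover have "ln (cmod (w - a) / 2) = ln (cmod (w - a)) - ln 2"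
          using w by (simp add: ln_div)
        moreover have "ln (cmod (w - of_real (t n) * a)) \<le> ln (2 * R)"
          using 3 4 R by (subst ln_le_cancel_iff) auto
        ultimately have "\<bar>ln (cmod (w - of_real (t n) * a))\<bar> \<le> \<bar>ln (cmod (w - a))\<bar> + (ln 2 + \<bar>ln (2 * R)\<bar>)"
          using ln_gt_zero[of "2::real"] by linarith
        hence "\<bar>poisson_kernel R z \<theta>\<bar> * \<bar>ln (cmod (w - of_real (t n) * a))\<bar> \<le> H \<theta>"
          unfolding H_def w_def[symmetric] using M[of \<theta>] \<open>M \<ge> 0\<close> by (intro mult_mono) auto
        thus ?thesis
          using False by (simp add: F_def w_def abs_mult)
      qed
    qed
    show "\<forall>\<theta>\<in>{0..2 * pi}. (\<lambda>n. F n \<theta>) \<longlonglongrightarrow> G \<theta>"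
    proof
      fix \<theta>
      show "(\<lambda>n. F n \<theta>) \<longlonglongrightarrow> G \<theta>"
      proof (cases "\<theta> \<in> N")
        case False
        hence "(\<lambda>n. poisson_kernel R z \<theta> * ln (cmod (of_real R * cis \<theta> - of_real (t n) * a))) \<longlonglongrightarrow>
            poisson_kernel R z \<theta> * ln (cmod (of_real R * cis \<theta> - of_real 1 * a))"
          by (intro tendsto_intros t_lim) (auto simp: N_def)
        thus ?thesis
          using False by (simp add: F_def G_def)
      qed (simp add: F_def G_def)
    qed
    have "(\<lambda>n. 2 * pi * ln (cmod (of_real (R\<^sup>2) - cnj (of_real (t n) * a) * z) / R)) \<longlonglongrightarrow>
        2 * pi * ln (cmod (of_real (R\<^sup>2) - cnj (of_real 1 * a) * z) / R)"
      using cmod_reflected_factor_pos[OF a z] R by (intro tendsto_intros t_lim) auto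
    thus "(\<lambda>n. 2 * pi * ln (cmod (of_real (R\<^sup>2) - cnj (of_real (t n) * a) * z) / R)) \<longlonglongrightarrow>
        2 * pi * ln (cmod (of_real (R\<^sup>2) - cnj a * z) / R)"
      by simp
  qed
  thus ?thesis
    by (rule has_integral_spike[OF N, rotated]) (auto simp: G_def)
qed

subsection \<open>Zeros and poles of a meromorphic function\<close>

lemma frequently_nonzero_linear: "\<exists>\<^sub>F w in at z. w - c \<noteq> (0::complex)"
proof -
  have "\<forall>\<^sub>F w in at z. w \<noteq> c"
    by (rule eventually_neq_at_within)
  thus ?thesis
    by (intro eventually_frequently) auto
qed

lemma zorder_linear: "zorder (\<lambda>w. w - c) z = (if z = c then 1 else 0 :: int)"
proof (cases "z = c")
  case True
  have "zorder (\<lambda>w. w - c) c = 1"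
    by (rule zorder_eqI[of UNIV c "\<lambda>_. 1"]) auto
  with True show ?thesis
    by simp
next
  case False
  have "zorder (\<lambda>w. w - c) z = 0"
    using False by (subst zorder_eq_0_iff) (auto intro!: analytic_intros frequently_nonzero_linear[simplified])
  with False show ?thesis
    by simp
qed

text \<open>A form of the identity theorem: it turns the assumption that \<open>f\<close> is not
  identically zero into sparseness of its zeros, the form used throughout.\<close>

lemma meromorphic_eventually_nonzero:
  assumes "f meromorphic_on UNIV" "\<not> (\<forall>\<^sub>\<approx>z\<in>UNIV. f z = 0)"
  shows "\<forall>\<^sub>\<approx>z\<in>UNIV. f z \<noteq> 0"
  using meromorphic_imp_constant_or_avoid[of f UNIV 0] assms by auto

lemma cosparse_eventually_at:
  assumes "\<forall>\<^sub>\<approx>z\<in>UNIV. P (z :: complex)"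
  shows "\<forall>\<^sub>F w in at z. P w"
  using assms by (simp add: eventually_cosparse_open_eq)

lemma finite_cball_cosparse:
  assumes "\<forall>\<^sub>\<approx>z\<in>UNIV. P (z :: complex)"
  shows "finite {z. cmod z \<le> R \<and> \<not> P z}"
proof -
  have "finite (cball 0 R \<inter> {z. \<not> P z})"
    using assms by (intro sparse_in_compact_finite) (auto simp: eventually_cosparse intro: sparse_in_subset)
  thus ?thesis
    by (simp add: Int_def)
qed

lemma is_pole_iff_zorder_neg:
  assumes "f meromorphic_on UNIV" "\<forall>\<^sub>\<approx>z\<in>UNIV. f z \<noteq> 0"
  shows "is_pole f z \<longleftrightarrow> zorder f z < 0"
proof -
  have m: "f meromorphic_on {z}"
    using assms(1) by (rule meromorphic_on_subset) auto
  have "\<forall>\<^sub>F w in at z. f w \<noteq> 0"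
    using assms(2) by (rule cosparse_eventually_at)
  thus ?thesis
    using m zorder_neg_imp_is_pole[of f z] isolated_pole_imp_neg_zorder[of f z]
    by (auto simp: meromorphic_at_iff)
qed

lemma cosparse_zorder_eq_0:
  assumes "f meromorphic_on UNIV" "\<forall>\<^sub>\<approx>z\<in>UNIV. f z \<noteq> 0"
  shows "\<forall>\<^sub>\<approx>z\<in>UNIV. zorder f z = 0"
  using meromorphic_on_imp_analytic_cosparse[OF assms(1)] assms(2)
proof eventually_elim
  case (elim z)
  have "\<exists>\<^sub>F w in at z. f w \<noteq> 0"
    using assms(2) by (intro eventually_frequently cosparse_eventually_at) auto
  thus ?case
    using elim by (simp add: zorder_eq_0_iff)
qed

text \<open>Multiplying \<open>f\<close> by the product \<open>p\<close> of the inverse factors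
  cancels every zero and pole of modulus below \<open>R\<^sub>1\<close>. Taking
  \<open>R\<^sub>1 > R\<close> makes the remaining factor regular across the boundary circle, even
  if \<open>f\<close> has zeros or poles on it.\<close>

lemma meromorphic_factorization:
  fixes f :: "complex \<Rightarrow> complex" and R :: real
  assumes mero: "f meromorphic_on UNIV" and nz: "\<forall>\<^sub>\<approx>z\<in>UNIV. f z \<noteq> 0"
  defines "Z \<equiv> {c. cmod c \<le> R \<and> zorder f c \<noteq> 0}"
  obtains g R\<^sub>1 where "R < R\<^sub>1" "g holomorphic_on ball 0 R\<^sub>1" "\<And>z. z \<in> ball 0 R\<^sub>1 \<Longrightarrow> g z \<noteq> 0"
    "\<forall>\<^sub>\<approx>z\<in>UNIV. f z = g z * (\<Prod>c\<in>Z. (z - c) powi zorder f c)"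
proof -
  define Z' where "Z' = {c. cmod c \<le> R + 1 \<and> zorder f c \<noteq> 0}"
  have fin': "finite Z'" and fin: "finite Z"
    unfolding Z_def Z'_def by (intro finite_cball_cosparse cosparse_zorder_eq_0 mero nz)+
  \<comment> \<open>The least modulus of the zeros and poles with R < |c| <= R + 1, or R + 1 if
    there are none; hence none has modulus strictly between \<open>R\<close> and
    \<open>R\<^sub>1\<close>.\<close>
  define R\<^sub>1 where "R\<^sub>1 = Min (insert (R + 1) {cmod c | c. c \<in> Z' \<and> cmod c > R})"
  have fin2: "finite (insert (R + 1) {cmod c | c. c \<in> Z' \<and> cmod c > R})"
    using fin' by simp
  have R1: "R < R\<^sub>1" "R\<^sub>1 \<le> R + 1"
    unfolding R\<^sub>1_def using fin2 by (auto simp: Min_le)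
  have Z1: "c \<in> Z" if "zorder f c \<noteq> 0" "cmod c < R\<^sub>1" for c
  proof (rule ccontr)
    assume "c \<notin> Z"
    hence "cmod c \<in> insert (R + 1) {cmod c | c. c \<in> Z' \<and> cmod c > R}"
      using that R1 by (auto simp: Z_def Z'_def)
    hence "R\<^sub>1 \<le> cmod c"
      unfolding R\<^sub>1_def using fin2 by (rule Min_le[rotated])
    with that show False
      by simp
  qed
  define p where "p = (\<lambda>z. \<Prod>c\<in>Z. (z - c) powi (- zorder f c))"
  define G where "G = (\<lambda>z. f z * p z)"
  have p_mero: "p meromorphic_on A" for A
    unfolding p_def by (intro meromorphic_intros)
  have p_nz: "\<forall>\<^sub>\<approx>z\<in>UNIV. p z \<noteq> 0"
  proof -
    have "\<forall>\<^sub>\<approx>z\<in>UNIV. \<forall>c\<in>Z. z \<noteq> c"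
      using fin by (intro eventually_ball_finite ballI) (auto simp: eventually_cosparse_open_eq eventually_neq_at_within)
    thus ?thesis
      by eventually_elim (use fin in \<open>auto simp: p_def\<close>)
  qed
  have freq: "\<exists>\<^sub>F w in at z. f w \<noteq> 0" "\<exists>\<^sub>F w in at z. p w \<noteq> 0" for z
    using nz p_nz by (intro eventually_frequently cosparse_eventually_at; simp)+
  have f_mero: "f meromorphic_on A" for A
    using mero by (rule meromorphic_on_subset) auto
  have G_mero: "G meromorphic_on A" for A
    unfolding G_def by (intro meromorphic_intros f_mero p_mero)
  have zorder_p: "zorder p z = (if z \<in> Z then - zorder f z else 0)" for z
  proof -
    have "zorder p z = (\<Sum>c\<in>Z. zorder (\<lambda>z. (z - c) powi (- zorder f c)) z)"
      unfolding p_def using cosparse_eventually_at[OF p_nz]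
      by (intro zorder_prod meromorphic_intros) (auto simp: p_def)
    also have "\<dots> = (\<Sum>c\<in>Z. if c = z then - zorder f c else 0)"
      by (intro sum.cong refl, subst zorder_power_int)
         (auto simp: zorder_linear intro!: meromorphic_intros frequently_nonzero_linear[simplified])
    finally show ?thesis
      using fin by simp
  qed
  have zorder_G: "zorder G z = 0" if "z \<in> ball 0 R\<^sub>1" for z
  proof -
    have "zorder G z = zorder f z + zorder p z"
      unfolding G_def by (intro zorder_mult f_mero p_mero freq)
    thus ?thesis
      using Z1[of z] that by (auto simp: zorder_p)
  qed
  have G_nz: "\<forall>\<^sub>\<approx>z\<in>UNIV. G z \<noteq> 0"
    using nz p_nz by eventually_elim (auto simp: G_def)
  \<comment> \<open>\<open>G\<close> has order 0 throughout the ball but may have arbitrary values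
    at isolated points; removing the singularities makes it analytic and zero-free there.\<close>
  define g where "g = remove_sings G"
  have gG: "\<forall>\<^sub>\<approx>z\<in>UNIV. g z = G z"
    unfolding g_def by (intro eventually_remove_sings_eq G_mero)
  have g_nice: "g nicely_meromorphic_on UNIV"
    unfolding g_def by (intro remove_sings_nicely_meromorphic G_mero)
  have g_nz: "\<forall>\<^sub>\<approx>z\<in>UNIV. g z \<noteq> 0"
    using gG G_nz by eventually_elim auto
  have zorder_g: "zorder g z = 0" if "z \<in> ball 0 R\<^sub>1" for z
    using zorder_G[OF that] G_mero[of "{z}"] unfolding g_def by (simp add: meromorphic_at_iff)
  have g_ana: "g analytic_on {z}" if "z \<in> ball 0 R\<^sub>1" for z
    using zorder_g[OF that] g_nice g_nz is_pole_iff_zorder_neg[of g z]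
    by (intro nicely_meromorphic_on_imp_analytic_at[OF g_nice]) (auto simp: nicely_meromorphic_on_def)
  show thesis
  proof
    show "R < R\<^sub>1"
      by fact
    show "g holomorphic_on ball 0 R\<^sub>1"
      using g_ana analytic_imp_holomorphic analytic_on_analytic_at by blast
    show "g z \<noteq> 0" if "z \<in> ball 0 R\<^sub>1" for z
    proof -
      have "\<exists>\<^sub>F w in at z. g w \<noteq> 0"
        using g_nz by (intro eventually_frequently cosparse_eventually_at) auto
      thus ?thesis
        using zorder_eq_0_iff[OF g_ana[OF that]] zorder_g[OF that] by blast
    qed
    show "\<forall>\<^sub>\<approx>z\<in>UNIV. f z = g z * (\<Prod>c\<in>Z. (z - c) powi zorder f c)"
      using gG p_nz
    proof eventually_elim
      case (elim z)
      have "z - c \<noteq> 0" if "c \<in> Z" for c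
        using elim(2) fin that by (auto simp: p_def Z_def)
      hence "p z * (\<Prod>c\<in>Z. (z - c) powi zorder f c) = (\<Prod>c\<in>Z. 1)"
        unfolding p_def prod.distrib[symmetric] by (intro prod.cong refl) (simp add: power_int_minus)
      thus ?case
        using elim by (simp add: G_def mult.assoc)
    qed
  qed
qed

text \<open>The zero-free factor has a holomorphic logarithm on the larger ball. The identity can
  fail only on a sparse set, of which the compact disc contains finitely many points.\<close>

lemma meromorphic_ln_cmod:
  fixes f :: "complex \<Rightarrow> complex" and R :: real
  assumes mero: "f meromorphic_on UNIV" and nz: "\<forall>\<^sub>\<approx>z\<in>UNIV. f z \<noteq> 0"
  defines "Z \<equiv> {c. cmod c \<le> R \<and> zorder f c \<noteq> 0}"
  obtains L where "L holomorphic_on ball 0 R" "continuous_on (cball 0 R) L"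
    "finite {z. cmod z \<le> R \<and> \<not> (f z \<noteq> 0 \<and>
       ln (cmod (f z)) = Re (L z) + (\<Sum>c\<in>Z. of_int (zorder f c) * ln (cmod (z - c))))}"
proof -
  have fin: "finite Z"
    unfolding Z_def by (intro finite_cball_cosparse cosparse_zorder_eq_0 mero nz)
  obtain g R\<^sub>1 where g: "R < R\<^sub>1" "g holomorphic_on ball 0 R\<^sub>1" "\<And>z. z \<in> ball 0 R\<^sub>1 \<Longrightarrow> g z \<noteq> 0"
    "\<forall>\<^sub>\<approx>z\<in>UNIV. f z = g z * (\<Prod>c\<in>Z. (z - c) powi zorder f c)"
    using meromorphic_factorization[OF mero nz, of R] unfolding Z_def by blast
  have "\<exists>L. L holomorphic_on ball 0 R\<^sub>1 \<and> (\<forall>z\<in>ball 0 R\<^sub>1. exp (L z) = g z)"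
  proof (cases "R\<^sub>1 > 0")
    case True
    obtain L where "L holomorphic_on ball 0 R\<^sub>1" "\<And>z. z \<in> ball 0 R\<^sub>1 \<Longrightarrow> exp (L z) = g z"
      by (rule holomorphic_logarithm_exists[OF _ _ g(2,3), of 0]) (use True in auto)
    thus ?thesis
      by blast
  next
    case False
    hence *: "ball (0 :: complex) R\<^sub>1 = {}"
      by simp
    show ?thesis
      using g(2) unfolding * by auto
  qed
  then obtain L where L: "L holomorphic_on ball 0 R\<^sub>1" "\<And>z. z \<in> ball 0 R\<^sub>1 \<Longrightarrow> exp (L z) = g z"
    by blast
  have "\<forall>\<^sub>\<approx>z\<in>UNIV. z \<notin> Z"
    using fin by (auto simp: eventually_cosparse finite_imp_sparse)
  with g(4) nz have "\<forall>\<^sub>\<approx>z\<in>UNIV. f z \<noteq> 0 \<and> f z = g z * (\<Prod>c\<in>Z. (z - c) powi zorder f c) \<and> z \<notin> Z"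
    by eventually_elim blast
  hence "finite {z. cmod z \<le> R \<and> \<not> (f z \<noteq> 0 \<and> f z = g z * (\<Prod>c\<in>Z. (z - c) powi zorder f c) \<and> z \<notin> Z)}"
    by (rule finite_cball_cosparse)
  moreover have "ln (cmod (f z)) = Re (L z) + (\<Sum>c\<in>Z. of_int (zorder f c) * ln (cmod (z - c)))"
    if "cmod z \<le> R" "f z = g z * (\<Prod>c\<in>Z. (z - c) powi zorder f c)" "z \<notin> Z" for z
  proof -
    have z: "z \<in> ball 0 R\<^sub>1"
      using that g(1) by auto
    have nz: "\<forall>c\<in>Z. cmod (z - c) \<noteq> 0"
      using that(3) by auto
    have "cmod (f z) = exp (Re (L z)) * (\<Prod>c\<in>Z. cmod (z - c) powi zorder f c)"
      unfolding that(2) L(2)[OF z, symmetric] by (simp add: norm_mult norm_power_int flip: prod_norm)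
    hence "ln (cmod (f z)) = Re (L z) + ln (\<Prod>c\<in>Z. cmod (z - c) powi zorder f c)"
      using nz fin by (simp add: ln_mult)
    also have "ln (\<Prod>c\<in>Z. cmod (z - c) powi zorder f c) = (\<Sum>c\<in>Z. ln (cmod (z - c) powi zorder f c))"
      using nz fin by (intro ln_prod) auto
    also have "\<dots> = (\<Sum>c\<in>Z. of_int (zorder f c) * ln (cmod (z - c)))"
      using nz by (intro sum.cong refl) (auto simp: ln_powr simp flip: powr_real_of_int')
    finally show ?thesis .
  qed
  ultimately have "finite {z. cmod z \<le> R \<and> \<not> (f z \<noteq> 0 \<and>
       ln (cmod (f z)) = Re (L z) + (\<Sum>c\<in>Z. of_int (zorder f c) * ln (cmod (z - c))))}"
    by (elim finite_subset[rotated]) auto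
  moreover have "L holomorphic_on ball 0 R" "continuous_on (cball 0 R) L"
    using L(1) g(1) by (auto intro: holomorphic_on_subset holomorphic_on_imp_continuous_on continuous_on_subset)
  ultimately show thesis
    using that by blast
qed

subsection \<open>Nevanlinna functions\<close>

text \<open>For x > 0 the positive parts of ln x and ln (1 / x) add up to |ln x|. The function
  \<open>h\<close> stands in for ln |g| off a null set, so values of \<open>g\<close> at exceptional
  points do not matter.\<close>

lemma proximity_fun_add_inverse:
  assumes N: "negligible N" and h: "h absolutely_integrable_on {0..2 * pi}"
    and g: "\<And>\<theta>. \<theta> \<in> {0..2 * pi} - N \<Longrightarrow> g (of_real r * cis \<theta>) \<noteq> 0 \<and> ln (cmod (g (of_real r * cis \<theta>))) = h \<theta>"
  shows "proximity_fun r g + proximity_fun r (\<lambda>z. 1 / g z) = 1 / (2 * pi) * integral {0..2 * pi} (\<lambda>\<theta>. \<bar>h \<theta>\<bar>)"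
proof -
  have int: "h integrable_on {0..2 * pi}" "(\<lambda>\<theta>. \<bar>h \<theta>\<bar>) integrable_on {0..2 * pi}"
    using h by (auto simp: absolutely_integrable_on_def)
  have lp: "log_plus x = (\<bar>ln x\<bar> + ln x) / 2" "log_plus (1 / x) = (\<bar>ln x\<bar> - ln x) / 2" if "x > 0" for x
    using that by (auto simp: log_plus_def ln_div divide_simps)
  have "integral {0..2 * pi} (\<lambda>\<theta>. log_plus (cmod (g (of_real r * cis \<theta>)))) = integral {0..2 * pi} (\<lambda>\<theta>. (\<bar>h \<theta>\<bar> + h \<theta>) / 2)"
    by (rule integral_spike[OF N]) (use g in \<open>auto simp: lp\<close>)
  moreover have "integral {0..2 * pi} (\<lambda>\<theta>. log_plus (cmod (1 / g (of_real r * cis \<theta>)))) = integral {0..2 * pi} (\<lambda>\<theta>. (\<bar>h \<theta>\<bar> - h \<theta>) / 2)"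
    by (rule integral_spike[OF N]) (use g in \<open>auto simp: lp(2) norm_divide\<close>)
  moreover have "integral {0..2 * pi} (\<lambda>\<theta>. (\<bar>h \<theta>\<bar> + h \<theta>) / 2) + integral {0..2 * pi} (\<lambda>\<theta>. (\<bar>h \<theta>\<bar> - h \<theta>) / 2) =
      integral {0..2 * pi} (\<lambda>\<theta>. (\<bar>h \<theta>\<bar> + h \<theta>) / 2 + (\<bar>h \<theta>\<bar> - h \<theta>) / 2)"
    using int by (intro integral_add[symmetric] integrable_on_divide integrable_add integrable_diff)
  moreover have "(\<lambda>\<theta>. (\<bar>h \<theta>\<bar> + h \<theta>) / 2 + (\<bar>h \<theta>\<bar> - h \<theta>) / 2) = (\<lambda>\<theta>. \<bar>h \<theta>\<bar>)"
    by (auto simp: field_simps)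
  ultimately show ?thesis
    by (simp only: proximity_fun_def distrib_left[symmetric])
qed

section \<open>Bounding the number of zeros and poles by the integrated counting functions\<close>

lemma has_integral_truncated_inverse:
  fixes a b :: real
  assumes "0 < a" "a \<le> b"
  shows "((\<lambda>t. if a \<le> t then 1 / t else 0) has_integral ln (b / a)) {0..b}"
proof -
  have "((\<lambda>t. 1 / t) has_integral ln b - ln a) {a..b}"
    using assms
    by (intro fundamental_theorem_of_calculus)
       (auto intro!: derivative_eq_intros simp: has_real_derivative_iff_has_vector_derivative[symmetric])
  hence "((\<lambda>t. if t \<in> {a..b} then 1 / t else 0) has_integral ln (b / a)) {0..b}"
    using assms by (subst has_integral_restrict) (auto simp: ln_div)
  thus ?thesis
    by (rule has_integral_eq[rotated]) auto
qed

text \<open>The integrated count is a sum over the poles of modulus at most \<open>R'\<close>. Those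
  of modulus at most \<open>R\<close> contribute at least ln (R' / R) per unit of multiplicity, a
  pole at 0 because R >= 1; the others contribute nonnegatively.\<close>

lemma pole_count_mult_ln_le_integrated_count:
  assumes mero: "f meromorphic_on UNIV" and nz: "\<forall>\<^sub>\<approx>z\<in>UNIV. f z \<noteq> 0" and R: "1 \<le> R" "R < R'"
  shows "real (pole_count R f) * ln (R' / R) \<le> integrated_count R' f"
proof -
  define P where "P = {z. cmod z \<le> R' \<and> is_pole f z}"
  define m where "m = (\<lambda>z. real (nat (- zorder f z)))"
  have fin: "finite P"
    unfolding P_def using finite_cball_cosparse[OF meromorphic_on_imp_not_pole_cosparse[OF mero], of R'] by simp
  have count: "real (pole_count t f) = (\<Sum>z\<in>P. if cmod z \<le> t then m z else 0)" if "t \<le> R'" for t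
  proof -
    have "{z. cmod z \<le> t \<and> is_pole f z} = {z \<in> P. cmod z \<le> t}"
      using that by (auto simp: P_def)
    thus ?thesis
      unfolding pole_count_def m_def of_nat_sum using fin by (simp add: sum.inter_filter)
  qed
  define n\<^sub>0 where "n\<^sub>0 = real (pole_count 0 f)"
  have split: "real (pole_count t f) = n\<^sub>0 + (\<Sum>z\<in>P - {0}. if cmod z \<le> t then m z else 0)" if "0 \<le> t" "t \<le> R'" for t
  proof -
    have "(\<Sum>z\<in>P. if cmod z \<le> t then m z else 0) = (\<Sum>z\<in>P. (if cmod z \<le> 0 then m z else 0) + (if z \<noteq> 0 then if cmod z \<le> t then m z else 0 else 0))"
      using that by (intro sum.cong) auto
    also have "\<dots> = n\<^sub>0 + (\<Sum>z\<in>P. if z \<noteq> 0 then if cmod z \<le> t then m z else 0 else 0)"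
      unfolding n\<^sub>0_def using R by (simp add: sum.distrib count)
    also have "(\<Sum>z\<in>P. if z \<noteq> 0 then if cmod z \<le> t then m z else 0 else 0) = (\<Sum>z\<in>{z\<in>P. z \<noteq> 0}. if cmod z \<le> t then m z else 0)"
      using fin by (intro sum.inter_filter[symmetric])
    also have "{z\<in>P. z \<noteq> 0} = P - {0}"
      by auto
    finally show ?thesis
      using that by (simp add: count)
  qed
  \<comment> \<open>A pole z other than 0 enters the count at t = |z|, so it contributes the
    integral of 1 / t from |z| to R'.\<close>
  have "((\<lambda>t. \<Sum>z\<in>P - {0}. m z * (if cmod z \<le> t then 1 / t else 0)) has_integral (\<Sum>z\<in>P - {0}. m z * ln (R' / cmod z))) {0..R'}"
    using fin by (intro has_integral_sum has_integral_mult_right has_integral_truncated_inverse) (auto simp: P_def)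
  hence "((\<lambda>t. (real (pole_count t f) - real (pole_count 0 f)) / t) has_integral (\<Sum>z\<in>P - {0}. m z * ln (R' / cmod z))) {0..R'}"
  proof (rule has_integral_eq[rotated])
    fix t assume "t \<in> {0..R'}"
    hence eq: "real (pole_count t f) - real (pole_count 0 f) = (\<Sum>z\<in>P - {0}. if cmod z \<le> t then m z else 0)"
      using split[of t] by (simp add: n\<^sub>0_def)
    show "(\<Sum>z\<in>P - {0}. m z * (if cmod z \<le> t then 1 / t else 0)) = (real (pole_count t f) - real (pole_count 0 f)) / t"
      unfolding eq sum_divide_distrib by (intro sum.cong refl) auto
  qed
  hence N: "integrated_count R' f = (\<Sum>z\<in>P - {0}. m z * ln (R' / cmod z)) + n\<^sub>0 * ln R'"
    unfolding integrated_count_def n\<^sub>0_def by (simp add: integral_unique)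
  have "real (pole_count R f) * ln (R' / R) =
      (\<Sum>z\<in>P - {0}. (if cmod z \<le> R then m z else 0) * ln (R' / R)) + n\<^sub>0 * ln (R' / R)"
    using R by (simp add: split algebra_simps sum_distrib_left sum_distrib_right)
  also have "\<dots> \<le> (\<Sum>z\<in>P - {0}. m z * ln (R' / cmod z)) + n\<^sub>0 * ln R'"
  proof (intro add_mono sum_mono)
    fix z assume z: "z \<in> P - {0}"
    have m: "m z \<ge> 0"
      by (simp add: m_def)
    show "(if cmod z \<le> R then m z else 0) * ln (R' / R) \<le> m z * ln (R' / cmod z)"
    proof (cases "cmod z \<le> R")
      case True
      hence "ln (R' / R) \<le> ln (R' / cmod z)"
        using z R by (subst ln_le_cancel_iff) (auto intro!: divide_left_mono)
      thus ?thesis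
        using True m by (simp add: mult_left_mono)
    next
      case False
      have "ln (R' / cmod z) \<ge> 0"
        using z R by (intro ln_ge_zero) (auto simp: P_def)
      thus ?thesis
        using False m by simp
    qed
  next
    have "ln (R' / R) \<le> ln R'"
      using R by (subst ln_le_cancel_iff) (auto simp: field_simps)
    thus "n\<^sub>0 * ln (R' / R) \<le> n\<^sub>0 * ln R'"
      by (simp add: n\<^sub>0_def mult_left_mono)
  qed
  finally show ?thesis
    using N by simp
qed

text \<open>Passing to 1 / f reverses the sign of every order, and nat (-k) + nat k = |k|.\<close>

lemma pole_count_add_inverse:
  assumes mero: "f meromorphic_on UNIV" and nz: "\<forall>\<^sub>\<approx>z\<in>UNIV. f z \<noteq> 0"
  shows "real (pole_count R f + pole_count R (\<lambda>z. 1 / f z)) = (\<Sum>c | cmod c \<le> R \<and> zorder f c \<noteq> 0. \<bar>of_int (zorder f c)\<bar>)"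
proof -
  define Z where "Z = {c. cmod c \<le> R \<and> zorder f c \<noteq> 0}"
  have fin: "finite Z"
    unfolding Z_def by (intro finite_cball_cosparse cosparse_zorder_eq_0 mero nz)
  have mero': "(\<lambda>z. 1 / f z) meromorphic_on UNIV"
    by (intro meromorphic_intros mero)
  have nz': "\<forall>\<^sub>\<approx>z\<in>UNIV. 1 / f z \<noteq> 0"
    using nz by eventually_elim auto
  have zorder': "zorder (\<lambda>z. 1 / f z) z = - zorder f z" for z
  proof -
    have "\<exists>\<^sub>F w in at z. f w \<noteq> 0"
      using nz by (intro eventually_frequently cosparse_eventually_at) auto
    moreover have "f meromorphic_on {z}"
      using mero by (rule meromorphic_on_subset) auto
    ultimately have "zorder (\<lambda>z. f z powi (-1)) z = - zorder f z"
      by (subst zorder_power_int) auto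
    thus ?thesis
      by (simp add: power_int_minus divide_inverse)
  qed
  have real_nat: "real (nat (- k) + nat k) = \<bar>of_int k\<bar>" for k :: int
    by (cases "k \<ge> 0") auto
  have 1: "pole_count R f = (\<Sum>c\<in>Z. nat (- zorder f c))"
    unfolding pole_count_def is_pole_iff_zorder_neg[OF mero nz]
    using fin by (intro sum.mono_neutral_left) (auto simp: Z_def)
  have 2: "pole_count R (\<lambda>z. 1 / f z) = (\<Sum>c\<in>Z. nat (zorder f c))"
    unfolding pole_count_def is_pole_iff_zorder_neg[OF mero' nz'] zorder'
    using fin by (simp, intro sum.mono_neutral_left) (auto simp: Z_def)
  have "real (\<Sum>c\<in>Z. nat (- zorder f c) + nat (zorder f c)) = (\<Sum>c\<in>Z. \<bar>of_int (zorder f c)\<bar>)"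
    unfolding of_nat_sum using real_nat by (intro sum.cong refl)
  thus ?thesis
    by (simp add: 1 2 sum.distrib Z_def)
qed

text \<open>The counting bound carries the factor ln (R' / R), and ln x <= x - 1 at x = R / R' gives
  ln (R' / R) >= (R' - R) / R'.\<close>

lemma sum_abs_zorder_le_integrated_count:
  assumes mero: "f meromorphic_on UNIV" and nz: "\<forall>\<^sub>\<approx>z\<in>UNIV. f z \<noteq> 0" and R: "1 \<le> R" "R < R'"
  shows "(\<Sum>c | cmod c \<le> R \<and> zorder f c \<noteq> 0. \<bar>of_int (zorder f c)\<bar>) \<le>
    R' / (R' - R) * (integrated_count R' f + integrated_count R' (\<lambda>z. 1 / f z))"
proof -
  define n where "n = (\<Sum>c | cmod c \<le> R \<and> zorder f c \<noteq> 0. \<bar>real_of_int (zorder f c)\<bar>)"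
  have "n * ln (R' / R) = real (pole_count R f) * ln (R' / R) + real (pole_count R (\<lambda>z. 1 / f z)) * ln (R' / R)"
    unfolding n_def pole_count_add_inverse[OF mero nz, symmetric] by (simp add: algebra_simps)
  also have "\<dots> \<le> integrated_count R' f + integrated_count R' (\<lambda>z. 1 / f z)"
  proof (intro add_mono pole_count_mult_ln_le_integrated_count mero nz R)
    show "(\<lambda>z. 1 / f z) meromorphic_on UNIV"
      by (intro meromorphic_intros mero)
    show "\<forall>\<^sub>\<approx>z\<in>UNIV. 1 / f z \<noteq> 0"
      using nz by eventually_elim auto
  qed
  finally have le: "n * ln (R' / R) \<le> integrated_count R' f + integrated_count R' (\<lambda>z. 1 / f z)" .
  have "ln (R / R') \<le> R / R' - 1"
    using R by (intro ln_le_minus_one) auto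
  hence "(R' - R) / R' \<le> ln (R' / R)"
    using R by (simp add: ln_div field_simps)
  moreover have "n \<ge> 0"
    unfolding n_def by (intro sum_nonneg) auto
  ultimately have "n * ((R' - R) / R') \<le> n * ln (R' / R)"
    by (intro mult_left_mono)
  with le have "n * ((R' - R) / R') \<le> integrated_count R' f + integrated_count R' (\<lambda>z. 1 / f z)"
    by linarith
  thus ?thesis
    using R unfolding n_def[symmetric] by (simp add: field_simps)
qed

subsection \<open>The shift quotient\<close>

text \<open>If x <= 1, then ln (1 + x) <= x <= x^alpha. If x > 1, then ln (1 + x) <= ln 2 + ln x,
  and each summand is at most x^alpha / alpha; hence the 2.\<close>

lemma ln_one_plus_le_powr:
  fixes x \<alpha> :: real
  assumes "x \<ge> 0" "0 < \<alpha>" "\<alpha> \<le> 1"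
  shows "ln (1 + x) \<le> 2 / \<alpha> * x powr \<alpha>"
proof (cases "x \<le> 1")
  case True
  have "ln (1 + x) \<le> x"
    using assms by (intro ln_add_one_self_le_self)
  also have "x \<le> x powr \<alpha>"
    using True assms powr_mono'[of \<alpha> 1 x] by simp
  also have "\<dots> \<le> 2 / \<alpha> * x powr \<alpha>"
    using assms by (intro mult_le_cancel_right1[THEN iffD2]) (auto simp: field_simps)
  finally show ?thesis .
next
  case False
  have ge1: "x powr \<alpha> \<ge> 1"
    using False assms by (intro ge_one_powr_ge_zero) auto
  have "ln (1 + x) \<le> ln (2 * x)"
    using False by simp
  also have "\<dots> = ln 2 + ln x"
    using False by (simp add: ln_mult)
  also have "ln 2 \<le> (1::real)"
    using ln_2_less_1 by simp
  also have "1 \<le> x powr \<alpha> / \<alpha>"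
    using ge1 assms by (simp add: field_simps)
  also have "ln x = ln (x powr \<alpha>) / \<alpha>"
    using False assms by (simp add: ln_powr)
  also have "\<dots> \<le> x powr \<alpha> / \<alpha>"
    using False assms ln_le_minus_one[of "x powr \<alpha>"] by (intro divide_right_mono) auto
  finally show ?thesis
    by simp
qed

text \<open>One direction follows from |u| / |v| <= 1 + |u - v| / |v| and
  \<open>ln_one_plus_le_powr\<close>; exchanging \<open>u\<close> and \<open>v\<close> gives the
  other.\<close>

lemma abs_ln_cmod_diff_le_powr:
  assumes "u \<noteq> 0" "v \<noteq> 0" "0 < \<alpha>" "\<alpha> \<le> 1"
  shows "\<bar>ln (cmod u) - ln (cmod v)\<bar> \<le>
    2 / \<alpha> * cmod (u - v) powr \<alpha> * (cmod u powr (-\<alpha>) + cmod v powr (-\<alpha>))"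
proof -
  have *: "ln (cmod u) - ln (cmod v) \<le> 2 / \<alpha> * cmod (u - v) powr \<alpha> * cmod v powr (-\<alpha>)"
    if "u \<noteq> 0" "v \<noteq> 0" for u v :: complex
  proof -
    have "cmod u / cmod v \<le> 1 + cmod (u - v) / cmod v"
      using that norm_triangle_ineq2[of u v] by (simp add: field_simps)
    hence "ln (cmod u / cmod v) \<le> ln (1 + cmod (u - v) / cmod v)"
      using that by (subst ln_le_cancel_iff) (auto intro: add_pos_nonneg)
    also have "\<dots> \<le> 2 / \<alpha> * (cmod (u - v) / cmod v) powr \<alpha>"
      using assms by (intro ln_one_plus_le_powr) auto
    also have "\<dots> = 2 / \<alpha> * cmod (u - v) powr \<alpha> * cmod v powr (-\<alpha>)"
      by (simp add: powr_divide powr_minus field_simps)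
    finally show ?thesis
      using that by (simp add: ln_div)
  qed
  have nonneg: "0 \<le> 2 / \<alpha> * cmod (u - v) powr \<alpha> * cmod u powr (-\<alpha>)" "0 \<le> 2 / \<alpha> * cmod (u - v) powr \<alpha> * cmod v powr (-\<alpha>)"
    using assms by auto
  show ?thesis
    using *[OF assms(1,2)] *[OF assms(2,1)] nonneg
    unfolding distrib_left abs_le_iff norm_minus_commute[of v u] by linarith
qed

text \<open>Between \<open>z\<close> and \<open>w\<close> the reflected factor changes by at most R
  |w - z|, while its modulus is at least R (R - rho); then ln A - ln B <= (A - B) / B.\<close>

lemma abs_ln_reflected_factor_diff_le:
  assumes "cmod c \<le> R" "cmod z \<le> \<rho>" "cmod w \<le> \<rho>" "\<rho> < R"
  shows "\<bar>ln (cmod (of_real (R\<^sup>2) - cnj c * w) / R) - ln (cmod (of_real (R\<^sup>2) - cnj c * z) / R)\<bar> \<le> cmod (w - z) / (R - \<rho>)"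
proof -
  have R: "R > 0"
    using assms norm_ge_zero[of z] by linarith
  have *: "ln (cmod (of_real (R\<^sup>2) - cnj c * w) / R) - ln (cmod (of_real (R\<^sup>2) - cnj c * z) / R) \<le> cmod (w - z) / (R - \<rho>)"
    if "cmod z \<le> \<rho>" "cmod w \<le> \<rho>" for z w
  proof -
    define A where "A = cmod (of_real (R\<^sup>2) - cnj c * w)"
    define B where "B = cmod (of_real (R\<^sup>2) - cnj c * z)"
    have pos: "A > 0" "B > 0"
      unfolding A_def B_def using assms that by (intro cmod_reflected_factor_pos; simp)+
    have "cmod (cnj c * z) \<le> R * \<rho>"
      unfolding norm_mult using assms that R by (intro mult_mono) auto
    hence B: "R * (R - \<rho>) \<le> B"
      using norm_triangle_ineq2[of "of_real (R\<^sup>2)" "cnj c * z"] R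
      by (simp add: B_def algebra_simps power2_eq_square norm_mult)
    have "A - B \<le> cmod ((of_real (R\<^sup>2) - cnj c * w) - (of_real (R\<^sup>2) - cnj c * z))"
      unfolding A_def B_def by (rule norm_triangle_ineq2)
    also have "(of_real (R\<^sup>2) - cnj c * w) - (of_real (R\<^sup>2) - cnj c * z) = cnj c * (z - w)"
      by (simp add: algebra_simps)
    also have "cmod \<dots> \<le> R * cmod (w - z)"
      using assms by (simp add: norm_mult norm_minus_commute mult_right_mono)
    finally have AB: "A - B \<le> R * cmod (w - z)" .
    have "ln (A / R) - ln (B / R) = ln A - ln B"
      using pos R by (simp add: ln_div)
    also have "\<dots> \<le> (A - B) / B"
      using pos by (intro ln_diff_le)
    also have "\<dots> \<le> R * cmod (w - z) / B"
      using AB pos by (intro divide_right_mono) auto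
    also have "\<dots> \<le> R * cmod (w - z) / (R * (R - \<rho>))"
      using B R pos assms by (intro divide_left_mono mult_pos_pos mult_nonneg_nonneg) auto
    also have "\<dots> = cmod (w - z) / (R - \<rho>)"
      using R by simp
    finally show ?thesis
      by (simp add: A_def B_def)
  qed
  show ?thesis
    using *[OF assms(2,3)] *[OF assms(3,2)] unfolding abs_le_iff norm_minus_commute[of z w] by linarith
qed

text \<open>Used with \<open>u\<close> equal to ln |f| on the circle of radius \<open>R\<close> up
  to a null set: the mean of |u| is then m(R, f) + m(R, 1/f), which produces the first term of the
  final estimate.\<close>

lemma poisson_integral_diff_le:
  assumes u: "u absolutely_integrable_on {0..2 * pi}" and rho: "cmod z \<le> \<rho>" "cmod w \<le> \<rho>" "\<rho> < R"
    and z: "((\<lambda>\<theta>. poisson_kernel R z \<theta> * u \<theta>) has_integral I) {0..2 * pi}"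
    and w: "((\<lambda>\<theta>. poisson_kernel R w \<theta> * u \<theta>) has_integral J) {0..2 * pi}"
  shows "\<bar>J - I\<bar> \<le> 2 * R * cmod (w - z) / (R - \<rho>)\<^sup>2 * integral {0..2 * pi} (\<lambda>\<theta>. \<bar>u \<theta>\<bar>)"
proof -
  have R: "R > 0"
    using rho norm_ge_zero[of z] by linarith
  define \<kappa> where "\<kappa> = 2 * R * cmod (w - z) / (R - \<rho>)\<^sup>2"
  have k: "\<bar>poisson_kernel R w \<theta> - poisson_kernel R z \<theta>\<bar> \<le> \<kappa>" for \<theta>
  proof -
    have "\<bar>poisson_kernel R w \<theta> - poisson_kernel R z \<theta>\<bar> \<le> 2 * R * cmod (w - z) / ((R - cmod w) * (R - cmod z))"
      using rho by (intro poisson_kernel_diff_le) auto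
    also have "\<dots> \<le> \<kappa>"
      unfolding \<kappa>_def power2_eq_square using rho R by (intro divide_left_mono mult_mono mult_pos_pos) auto
    finally show ?thesis .
  qed
  have "norm (integral {0..2 * pi} (\<lambda>\<theta>. poisson_kernel R w \<theta> * u \<theta> - poisson_kernel R z \<theta> * u \<theta>)) \<le>
      integral {0..2 * pi} (\<lambda>\<theta>. \<kappa> * \<bar>u \<theta>\<bar>)"
  proof (rule integral_norm_bound_integral)
    show "(\<lambda>\<theta>. poisson_kernel R w \<theta> * u \<theta> - poisson_kernel R z \<theta> * u \<theta>) integrable_on {0..2 * pi}"
      using has_integral_diff[OF w z] by blast
    show "(\<lambda>\<theta>. \<kappa> * \<bar>u \<theta>\<bar>) integrable_on {0..2 * pi}"
      using u by (intro integrable_on_mult_right) (simp add: absolutely_integrable_on_def)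
    show "norm (poisson_kernel R w \<theta> * u \<theta> - poisson_kernel R z \<theta> * u \<theta>) \<le> \<kappa> * \<bar>u \<theta>\<bar>" for \<theta>
      unfolding left_diff_distrib[symmetric] real_norm_def abs_mult using k by (intro mult_right_mono) auto
  qed
  moreover have "integral {0..2 * pi} (\<lambda>\<theta>. poisson_kernel R w \<theta> * u \<theta> - poisson_kernel R z \<theta> * u \<theta>) = J - I"
    by (rule integral_unique[OF has_integral_diff[OF w z]])
  ultimately show ?thesis
    by (simp add: \<kappa>_def)
qed

text \<open>\<open>K\<close> bounds integrals over the one circle of radius \<open>r\<close>, so it
  will carry the factor r^(-alpha). The coefficient 2 K / (pi alpha) collects 2 / alpha from
  \<open>abs_ln_cmod_diff_le_powr\<close>, 2 K from the singularities at c and c - eta, and the 1 /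
  (2 pi) of the mean.\<close>

lemma proximity_shift_quotient_le:
  fixes f :: "complex \<Rightarrow> complex"
  assumes \<alpha>: "0 < \<alpha>" "\<alpha> < 1"
    and K: "\<And>c. (\<lambda>\<theta>. cmod (of_real r * cis \<theta> - c) powr (-\<alpha>)) integrable_on {0..2 * pi}"
      "\<And>c. integral {0..2 * pi} (\<lambda>\<theta>. cmod (of_real r * cis \<theta> - c) powr (-\<alpha>)) \<le> K"
    and mero: "f meromorphic_on UNIV" and nz: "\<forall>\<^sub>\<approx>z\<in>UNIV. f z \<noteq> 0"
    and r: "r > 0" "r + cmod \<eta> < R"
  shows "proximity_fun r (\<lambda>z. f (z + \<eta>) / f z) + proximity_fun r (\<lambda>z. f z / f (z + \<eta>))
      \<le> 2 * cmod \<eta> * R / (R - r - cmod \<eta>)\<^sup>2 * (proximity_fun R f + proximity_fun R (\<lambda>z. 1 / f z))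
        + (cmod \<eta> / (R - r - cmod \<eta>) + 2 * K / (pi * \<alpha>) * cmod \<eta> powr \<alpha>)
            * (\<Sum>c | cmod c \<le> R \<and> zorder f c \<noteq> 0. \<bar>of_int (zorder f c)\<bar>)"
proof -
  define Z where "Z = {c. cmod c \<le> R \<and> zorder f c \<noteq> 0}"
  define \<rho> where "\<rho> = r + cmod \<eta>"
  define \<mu> where "\<mu> = (\<lambda>c. real_of_int (zorder f c))"
  \<comment> \<open>Per unit of order, \<open>q\<close> bounds the change of the reflected
    logarithms and \<open>s\<close> is the coefficient in the change of ln |z - c|;
    \<open>\<kappa>\<close> bounds the change of the Poisson kernel.\<close>
  define q where "q = cmod \<eta> / (R - \<rho>)"
  define s where "s = 2 / \<alpha> * cmod \<eta> powr \<alpha>"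
  define \<kappa> where "\<kappa> = 2 * R * cmod \<eta> / (R - \<rho>)\<^sup>2"
  define M where "M = proximity_fun R f + proximity_fun R (\<lambda>z. 1 / f z)"
  have R: "R > 0" "\<rho> < R"
    using r by (auto simp: \<rho>_def intro: le_less_trans[rotated] add_nonneg_nonneg)
  have "r \<le> R"
    using r norm_ge_zero[of \<eta>] by linarith
  have fin: "finite Z"
    unfolding Z_def by (intro finite_cball_cosparse cosparse_zorder_eq_0 mero nz)
  obtain L where L: "L holomorphic_on ball 0 R" "continuous_on (cball 0 R) L"
    "finite {z. cmod z \<le> R \<and> \<not> (f z \<noteq> 0 \<and> ln (cmod (f z)) = Re (L z) + (\<Sum>c\<in>Z. of_int (zorder f c) * ln (cmod (z - c))))}"
    using meromorphic_ln_cmod[OF mero nz, of R] unfolding Z_def by blast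
  define U where "U = (\<lambda>z. Re (L z) + (\<Sum>c\<in>Z. \<mu> c * ln (cmod (z - c))))"
  define E where "E = {z. cmod z \<le> R \<and> \<not> (f z \<noteq> 0 \<and> ln (cmod (f z)) = U z)}"
  have finE: "finite E"
    using L(3) unfolding E_def U_def \<mu>_def by simp
  have fE: "f z \<noteq> 0" "ln (cmod (f z)) = U z" if "cmod z \<le> R" "z \<notin> E" for z
    using that by (auto simp: E_def)
  have circ: "cmod (of_real t * cis \<theta>) = t" if "t > 0" for t \<theta>
    using that by (simp add: norm_mult)
  have U_int: "(\<lambda>\<theta>. U (of_real t * cis \<theta> + a)) absolutely_integrable_on {0..2 * pi}"
    if t: "t > 0" "t + cmod a \<le> R" for t a
  proof -
    have "cmod (of_real t * cis \<theta> + a) \<le> R" for \<theta>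
      using norm_triangle_ineq[of "of_real t * cis \<theta>" a] t circ[of t \<theta>] by linarith
    hence "continuous_on {0..2 * pi} (\<lambda>\<theta>. Re (L (of_real t * cis \<theta> + a)))"
      by (intro continuous_intros continuous_on_compose2[OF L(2)]) auto
    hence "(\<lambda>\<theta>. Re (L (of_real t * cis \<theta> + a))) absolutely_integrable_on {0..2 * pi}"
      by (rule absolutely_integrable_continuous_real)
    moreover have "(\<lambda>\<theta>. \<mu> c * ln (cmod (of_real t * cis \<theta> + a - c))) absolutely_integrable_on {0..2 * pi}" for c
      using set_integrable_mult_right[OF ln_cmod_circle_absolutely_integrable[OF t(1), of "c - a"], of "\<mu> c"]
      by (simp add: algebra_simps)
    ultimately show ?thesis
      unfolding U_def using fin by (intro set_integral_add absolutely_integrable_sum) auto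
  qed
  define u where "u = (\<lambda>\<theta>. U (of_real R * cis \<theta>))"
  have u_int: "u absolutely_integrable_on {0..2 * pi}"
    using U_int[of R 0] R by (simp add: u_def)
  have "M = 1 / (2 * pi) * integral {0..2 * pi} (\<lambda>\<theta>. \<bar>u \<theta>\<bar>)"
    unfolding M_def
  proof (rule proximity_fun_add_inverse[OF _ u_int])
    show "negligible {\<theta>. of_real R * cis \<theta> \<in> E}"
      using R finE by (intro negligible_circle_vimage) auto
  qed (use fE circ R in \<open>auto simp: u_def\<close>)
  hence M: "integral {0..2 * pi} (\<lambda>\<theta>. \<bar>u \<theta>\<bar>) = 2 * pi * M"
    by simp
  \<comment> \<open>The Poisson integral of \<open>u\<close> reproduces Re L but replaces each ln |z
    - c| by the logarithm of the reflected factor, which is harmonic in the disc; this is the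
    Poisson-Jensen formula.\<close>
  define D where "D = (\<lambda>z. \<Sum>c\<in>Z. \<mu> c * ln (cmod (of_real (R\<^sup>2) - cnj c * z) / R))"
  have poisson: "((\<lambda>\<theta>. poisson_kernel R z \<theta> * u \<theta>) has_integral 2 * pi * (Re (L z) + D z)) {0..2 * pi}"
    if z: "cmod z < R" for z
  proof -
    have "((\<lambda>\<theta>. poisson_kernel R z \<theta> * Re (L (of_real R * cis \<theta>)) +
        (\<Sum>c\<in>Z. \<mu> c * (poisson_kernel R z \<theta> * ln (cmod (of_real R * cis \<theta> - c))))) has_integral
        2 * pi * Re (L z) + (\<Sum>c\<in>Z. \<mu> c * (2 * pi * ln (cmod (of_real (R\<^sup>2) - cnj c * z) / R)))) {0..2 * pi}"
      using z fin L
      by (intro has_integral_add has_integral_sum has_integral_mult_right poisson_integral_formula poisson_integral_ln_cmod)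
         (auto simp: Z_def)
    thus ?thesis
      by (simp add: u_def U_def D_def distrib_left sum_distrib_left mult_ac)
  qed
  \<comment> \<open>Re L is the normalized Poisson integral of \<open>u\<close> minus
    \<open>D\<close>. The variation of the kernel controls the first difference and \<open>q\<close>
    the second.\<close>
  have L_diff: "\<bar>Re (L (z + \<eta>)) - Re (L z)\<bar> \<le> \<kappa> * M + (\<Sum>c\<in>Z. \<bar>\<mu> c\<bar> * q)" if z: "cmod z = r" for z
  proof -
    have zw: "cmod z \<le> \<rho>" "cmod (z + \<eta>) \<le> \<rho>"
      using z norm_triangle_ineq[of z \<eta>] by (auto simp: \<rho>_def)
    have "\<bar>2 * pi * (Re (L (z + \<eta>)) + D (z + \<eta>)) - 2 * pi * (Re (L z) + D z)\<bar> \<le> \<kappa> * (2 * pi * M)"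
      using poisson_integral_diff_le[OF u_int zw R(2) poisson poisson] zw R by (simp add: M \<kappa>_def)
    hence "2 * pi * \<bar>(Re (L (z + \<eta>)) + D (z + \<eta>)) - (Re (L z) + D z)\<bar> \<le> 2 * pi * (\<kappa> * M)"
      unfolding right_diff_distrib[symmetric] abs_mult by (simp add: mult_ac)
    hence 1: "\<bar>(Re (L (z + \<eta>)) + D (z + \<eta>)) - (Re (L z) + D z)\<bar> \<le> \<kappa> * M"
      by simp
    have "\<bar>D (z + \<eta>) - D z\<bar> \<le> (\<Sum>c\<in>Z. \<bar>\<mu> c\<bar> * q)"
      unfolding D_def sum_subtractf[symmetric] right_diff_distrib[symmetric]
    proof (rule order.trans[OF sum_abs sum_mono])
      fix c assume c: "c \<in> Z"
      have "\<bar>ln (cmod (of_real (R\<^sup>2) - cnj c * (z + \<eta>)) / R) - ln (cmod (of_real (R\<^sup>2) - cnj c * z) / R)\<bar> \<le> q"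
        using abs_ln_reflected_factor_diff_le[OF _ zw R(2), of c] c by (simp add: q_def Z_def)
      thus "\<bar>\<mu> c * (ln (cmod (of_real (R\<^sup>2) - cnj c * (z + \<eta>)) / R) - ln (cmod (of_real (R\<^sup>2) - cnj c * z) / R))\<bar> \<le> \<bar>\<mu> c\<bar> * q"
        unfolding abs_mult by (intro mult_left_mono) auto
    qed
    with 1 show ?thesis
      by linarith
  qed
  \<comment> \<open>Angles at which z or z + eta hits an exceptional point; the translated copy
    accounts for z + eta.\<close>
  define N where "N = {\<theta>. of_real r * cis \<theta> \<in> E \<union> Z \<union> (\<lambda>x. x - \<eta>) ` (E \<union> Z)}"
  have N: "negligible N"
    unfolding N_def using r fin finE by (intro negligible_circle_vimage) auto
  define h where "h = (\<lambda>\<theta>. if \<theta> \<in> N then 0 else U (of_real r * cis \<theta> + \<eta>) - U (of_real r * cis \<theta>))"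
  have h_int: "h absolutely_integrable_on {0..2 * pi}"
  proof (rule absolutely_integrable_spike[OF _ N])
    show "(\<lambda>\<theta>. U (of_real r * cis \<theta> + \<eta>) - U (of_real r * cis \<theta>)) absolutely_integrable_on {0..2 * pi}"
      using U_int[of r \<eta>] U_int[of r 0] r \<open>r \<le> R\<close> by (intro set_integral_diff) auto
  qed (auto simp: h_def)
  \<comment> \<open>Since |z + eta - c| = |z - (c - eta)|, the shifted singularity is handled on the
    same circle with c - eta in place of c.\<close>
  define G where "G = (\<lambda>c \<theta>. q + s * (cmod (of_real r * cis \<theta> - (c - \<eta>)) powr (-\<alpha>) + cmod (of_real r * cis \<theta> - c) powr (-\<alpha>)))"
  have nonneg: "q \<ge> 0" "s \<ge> 0" "\<kappa> \<ge> 0"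
    using R \<alpha> by (auto simp: q_def s_def \<kappa>_def)
  have "0 \<le> integral {0..2 * pi} (\<lambda>\<theta>. \<bar>u \<theta>\<bar>)"
    using u_int by (intro integral_nonneg) (auto simp: absolutely_integrable_on_def)
  hence M_nonneg: "M \<ge> 0"
    unfolding M using pi_gt_zero by (auto simp: zero_le_mult_iff)
  have const: "((\<lambda>\<theta>. k) has_integral 2 * pi * k) {0..2 * pi}" for k :: real
    using has_integral_const_real[of k 0 "2 * pi"] by simp
  define J where "J = (\<lambda>c. integral {0..2 * pi} (\<lambda>\<theta>. cmod (of_real r * cis \<theta> - c) powr (-\<alpha>)))"
  define I where "I = (\<lambda>c. 2 * pi * q + s * (J (c - \<eta>) + J c))"
  have "((\<lambda>\<theta>. cmod (of_real r * cis \<theta> - c) powr (-\<alpha>)) has_integral J c) {0..2 * pi}" for c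
    unfolding J_def using K(1) by (rule integrable_integral)
  hence G_int: "(G c has_integral I c) {0..2 * pi}" for c
    unfolding G_def I_def by (intro has_integral_add has_integral_mult_right const)
  have I_le: "I c \<le> 2 * pi * q + s * (2 * K)" for c
    using K(2)[of c] K(2)[of "c - \<eta>"] nonneg unfolding I_def J_def
    by (intro add_left_mono mult_left_mono) auto
  have bound_int: "((\<lambda>\<theta>. \<kappa> * M + (\<Sum>c\<in>Z. \<bar>\<mu> c\<bar> * G c \<theta>)) has_integral
      2 * pi * (\<kappa> * M) + (\<Sum>c\<in>Z. \<bar>\<mu> c\<bar> * I c)) {0..2 * pi}"
    using fin by (intro has_integral_add has_integral_sum has_integral_mult_right const G_int)
  have bound: "\<bar>h \<theta>\<bar> \<le> \<kappa> * M + (\<Sum>c\<in>Z. \<bar>\<mu> c\<bar> * G c \<theta>)" for \<theta>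
  proof (cases "\<theta> \<in> N")
    case True
    thus ?thesis
      using nonneg M_nonneg by (auto simp: h_def G_def intro!: add_nonneg_nonneg sum_nonneg mult_nonneg_nonneg)
  next
    case False
    define z where "z = of_real r * cis \<theta>"
    have z: "cmod z = r"
      using r by (simp add: z_def circ)
    have zc: "z - c \<noteq> 0" "z + \<eta> - c \<noteq> 0" if "c \<in> Z" for c
      using False that by (auto simp: N_def z_def algebra_simps image_iff)
    have "h \<theta> = (Re (L (z + \<eta>)) - Re (L z)) + (\<Sum>c\<in>Z. \<mu> c * (ln (cmod (z + \<eta> - c)) - ln (cmod (z - c))))"
      using False by (simp add: h_def U_def z_def sum_subtractf right_diff_distrib)
    also have "\<bar>\<dots>\<bar> \<le> (\<kappa> * M + (\<Sum>c\<in>Z. \<bar>\<mu> c\<bar> * q)) +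
        (\<Sum>c\<in>Z. \<bar>\<mu> c\<bar> * (s * (cmod (z + \<eta> - c) powr (-\<alpha>) + cmod (z - c) powr (-\<alpha>))))"
    proof (rule order.trans[OF abs_triangle_ineq add_mono[OF L_diff[OF z]]])
      show "\<bar>\<Sum>c\<in>Z. \<mu> c * (ln (cmod (z + \<eta> - c)) - ln (cmod (z - c)))\<bar> \<le>
          (\<Sum>c\<in>Z. \<bar>\<mu> c\<bar> * (s * (cmod (z + \<eta> - c) powr (-\<alpha>) + cmod (z - c) powr (-\<alpha>))))"
      proof (rule order.trans[OF sum_abs sum_mono])
        fix c assume c: "c \<in> Z"
        have "\<bar>ln (cmod (z + \<eta> - c)) - ln (cmod (z - c))\<bar> \<le> s * (cmod (z + \<eta> - c) powr (-\<alpha>) + cmod (z - c) powr (-\<alpha>))"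
          using abs_ln_cmod_diff_le_powr[of "z + \<eta> - c" "z - c" \<alpha>] zc[OF c] \<alpha> by (simp add: s_def)
        thus "\<bar>\<mu> c * (ln (cmod (z + \<eta> - c)) - ln (cmod (z - c)))\<bar> \<le>
            \<bar>\<mu> c\<bar> * (s * (cmod (z + \<eta> - c) powr (-\<alpha>) + cmod (z - c) powr (-\<alpha>)))"
          unfolding abs_mult by (intro mult_left_mono) auto
      qed
    qed
    also have "\<dots> = \<kappa> * M + (\<Sum>c\<in>Z. \<bar>\<mu> c\<bar> * G c \<theta>)"
      by (simp add: G_def z_def distrib_left sum.distrib diff_diff_eq2 add_ac)
    finally show ?thesis .
  qed
  have "proximity_fun r (\<lambda>z. f (z + \<eta>) / f z) + proximity_fun r (\<lambda>z. 1 / (f (z + \<eta>) / f z)) =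
      1 / (2 * pi) * integral {0..2 * pi} (\<lambda>\<theta>. \<bar>h \<theta>\<bar>)"
  proof (rule proximity_fun_add_inverse[OF N h_int])
    fix \<theta> assume th: "\<theta> \<in> {0..2 * pi} - N"
    define z where "z = of_real r * cis \<theta>"
    have "cmod z \<le> R" "cmod (z + \<eta>) \<le> R"
      using r \<open>r \<le> R\<close> circ[of r \<theta>] norm_triangle_ineq[of z \<eta>] by (auto simp: z_def)
    moreover have "z \<notin> E" "z + \<eta> \<notin> E"
      using th by (auto simp: N_def z_def image_iff algebra_simps)
    ultimately show "f (of_real r * cis \<theta> + \<eta>) / f (of_real r * cis \<theta>) \<noteq> 0 \<and>
        ln (cmod (f (of_real r * cis \<theta> + \<eta>) / f (of_real r * cis \<theta>))) = h \<theta>"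
      unfolding z_def[symmetric] using th fE[of z] fE[of "z + \<eta>"] by (simp add: h_def z_def[symmetric] norm_divide ln_div)
  qed
  also have "integral {0..2 * pi} (\<lambda>\<theta>. \<bar>h \<theta>\<bar>) \<le> 2 * pi * (\<kappa> * M) + (\<Sum>c\<in>Z. \<bar>\<mu> c\<bar> * I c)"
    unfolding integral_unique[OF bound_int, symmetric] using h_int bound_int bound
    by (intro integral_le) (auto simp: absolutely_integrable_on_def)
  also have "\<dots> \<le> 2 * pi * (\<kappa> * M) + (\<Sum>c\<in>Z. \<bar>\<mu> c\<bar> * (2 * pi * q + s * (2 * K)))"
    using I_le by (intro add_left_mono sum_mono mult_left_mono) auto
  also have "\<dots> = 2 * pi * (\<kappa> * M) + (\<Sum>c\<in>Z. \<bar>\<mu> c\<bar>) * (2 * pi * q + s * (2 * K))"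
    by (simp only: sum_distrib_right)
  also have "1 / (2 * pi) * \<dots> = \<kappa> * M + (q + s * K / pi) * (\<Sum>c\<in>Z. \<bar>\<mu> c\<bar>)"
    by (simp add: field_simps)
  finally have "proximity_fun r (\<lambda>z. f (z + \<eta>) / f z) + proximity_fun r (\<lambda>z. 1 / (f (z + \<eta>) / f z)) \<le>
      \<kappa> * M + (q + s * K / pi) * (\<Sum>c\<in>Z. \<bar>\<mu> c\<bar>)"
    by (simp add: divide_right_mono)
  moreover have "R - \<rho> = R - r - cmod \<eta>"
    by (simp add: \<rho>_def)
  ultimately show ?thesis
    by (simp add: \<kappa>_def M_def q_def s_def \<mu>_def Z_def mult_ac)
qed

theorem theorem2p4:
  fixes \<alpha> :: real
  assumes "0 < \<alpha>" and "\<alpha> < 1"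
  shows "\<exists>C::real. C > 0 \<and>
    (\<forall>(\<eta>::complex) (f::complex \<Rightarrow> complex) (r::real) (R::real) (R'::real).
      \<eta> \<noteq> 0 \<longrightarrow>
      f meromorphic_on UNIV \<longrightarrow>
      \<not> (\<forall>\<^sub>\<approx>z\<in>UNIV. f z = 0) \<longrightarrow>
      r > 0 \<longrightarrow>
      max 1 (r + cmod \<eta>) < R \<longrightarrow>
      R < R' \<longrightarrow>
      proximity_fun r (\<lambda>z. f (z + \<eta>) / f z) + proximity_fun r (\<lambda>z. f z / f (z + \<eta>))
      \<le> 2 * cmod \<eta> * R / (R - r - cmod \<eta>)\<^sup>2
            * (proximity_fun R f + proximity_fun R (\<lambda>z. 1 / f z))
        + 2 * R' / (R' - R)
            * (cmod \<eta> / (R - r - cmod \<eta>)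
               + C * cmod \<eta> powr \<alpha> / ((1 - \<alpha>) * r powr \<alpha>))
            * (integrated_count R' f + integrated_count R' (\<lambda>z. 1 / f z)))"
proof -
  obtain K where K: "K > 0"
    "\<And>r c. r > 0 \<Longrightarrow> (\<lambda>\<theta>. cmod (of_real r * cis \<theta> - c) powr (-\<alpha>)) integrable_on {0..2 * pi}"
    "\<And>r c. r > 0 \<Longrightarrow> integral {0..2 * pi} (\<lambda>\<theta>. cmod (of_real r * cis \<theta> - c) powr (-\<alpha>)) \<le> K * r powr (-\<alpha>)"
    using circle_powr_integral_bound[OF assms] by blast
  \<comment> \<open>The factor 1 - alpha cancels the one in the denominator of the claim; the rest
    is the coefficient from \<open>proximity_shift_quotient_le\<close>, with r^(-alpha) split
    off.\<close>
  define C where "C = 2 * K * (1 - \<alpha>) / (pi * \<alpha>)"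
  have "C > 0"
    using K assms by (simp add: C_def)
  show ?thesis
  proof (intro exI[of _ C] conjI allI impI \<open>C > 0\<close>)
    fix \<eta> :: complex and f :: "complex \<Rightarrow> complex" and r R R' :: real
    assume mero: "f meromorphic_on UNIV" and not_zero: "\<not> (\<forall>\<^sub>\<approx>z\<in>UNIV. f z = 0)"
      and r: "r > 0" and R: "max 1 (r + cmod \<eta>) < R" and R': "R < R'"
    have nz: "\<forall>\<^sub>\<approx>z\<in>UNIV. f z \<noteq> 0"
      using mero not_zero by (rule meromorphic_eventually_nonzero)
    define Q where "Q = cmod \<eta> / (R - r - cmod \<eta>) + C * cmod \<eta> powr \<alpha> / ((1 - \<alpha>) * r powr \<alpha>)"
    define S where "S = (\<Sum>c | cmod c \<le> R \<and> zorder f c \<noteq> 0. \<bar>real_of_int (zorder f c)\<bar>)"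
    define T where "T = integrated_count R' f + integrated_count R' (\<lambda>z. 1 / f z)"
    have "proximity_fun r (\<lambda>z. f (z + \<eta>) / f z) + proximity_fun r (\<lambda>z. f z / f (z + \<eta>))
      \<le> 2 * cmod \<eta> * R / (R - r - cmod \<eta>)\<^sup>2 * (proximity_fun R f + proximity_fun R (\<lambda>z. 1 / f z))
        + (cmod \<eta> / (R - r - cmod \<eta>) + 2 * (K * r powr (-\<alpha>)) / (pi * \<alpha>) * cmod \<eta> powr \<alpha>) * S"
      unfolding S_def using assms K r R mero nz by (intro proximity_shift_quotient_le) auto
    also have "cmod \<eta> / (R - r - cmod \<eta>) + 2 * (K * r powr (-\<alpha>)) / (pi * \<alpha>) * cmod \<eta> powr \<alpha> = Q"
      using assms r by (simp add: Q_def C_def powr_minus field_simps)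
    also have "Q * S \<le> Q * (2 * R' / (R' - R) * T)"
    proof (rule mult_left_mono)
      have "S \<le> R' / (R' - R) * T"
        unfolding S_def T_def using mero nz R R' by (intro sum_abs_zorder_le_integrated_count) auto
      \<comment> \<open>As \<open>S\<close> is nonnegative, so is its upper bound, and doubling that
        bound preserves the inequality.\<close>
      moreover have "S \<ge> 0"
        unfolding S_def by (intro sum_nonneg) auto
      ultimately show "S \<le> 2 * R' / (R' - R) * T"
        by simp
      show "Q \<ge> 0"
        using \<open>C > 0\<close> assms R by (auto simp: Q_def intro!: add_nonneg_nonneg divide_nonneg_nonneg)
    qed
    finally show "proximity_fun r (\<lambda>z. f (z + \<eta>) / f z) + proximity_fun r (\<lambda>z. f z / f (z + \<eta>))
      \<le> 2 * cmod \<eta> * R / (R - r - cmod \<eta>)\<^sup>2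
            * (proximity_fun R f + proximity_fun R (\<lambda>z. 1 / f z))
        + 2 * R' / (R' - R)
            * (cmod \<eta> / (R - r - cmod \<eta>)
               + C * cmod \<eta> powr \<alpha> / ((1 - \<alpha>) * r powr \<alpha>))
            * (integrated_count R' f + integrated_count R' (\<lambda>z. 1 / f z))"
      unfolding Q_def[symmetric] T_def[symmetric] by (simp only: mult_ac)
  qed
qed

end
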